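(* Let $p$ be a prime, $P$ a finite $p$-group, and $k$ an algebraically closed field of characteristic $p$. Then $\mathrm{mt}\text{-}\mathrm{rank}(\mathrm{HH}^1(kP))$ is the minimal number of generators of $P$.
   Context: $kP$ is the group algebra. $\mathrm{HH}^1(A)=\mathrm{Der}(A)/\mathrm{Inn}(A)$ is the Lie algebra of $k$-linear derivations of $A$ modulo inner derivations; it is a restricted Lie algebra with $p$-power operation induced by $f\mapsto f^p$ on derivations. A torus is a restricted subalgebra that is abelian and each of whose elements $x$ is semisimple, i.e. $x$ lies in the restricted subalgebra generated by $x^{[p]}$. $\mathrm{mt}\text{-}\mathrm{rank}(\mathrm{HH}^1(A))$ is the maximal dimension of a torus in $\mathrm{HH}^1(A)$. *)

theory Defs
  imports "HOL-Computational_Algebra.Polynomial"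
    "HOL-Algebra.QuotRing" "HOL-Algebra.Module" "HOL-Algebra.Generated_Groups"
begin

text \<open>
  The ground field is a type \<open>'k\<close> of class \<^class>\<open>field\<close>.  A \<open>'k\<close>-algebra is a record of type
  \<^typ>\<open>('k, 'a) module\<close>, which has all the operations of a ring together with a scalar
  multiplication.  An element of the group algebra is the coefficient function of
  \<open>\<Sum>g\<in>P. f g \<cdot> g\<close>, extended by \<open>0\<close> outside the carrier of \<open>P\<close>.
\<close>

definition group_algebra :: "('g, 'b) monoid_scheme \<Rightarrow> ('k::field, 'g \<Rightarrow> 'k) module" where
  "group_algebra P =
    \<lparr>carrier = {f. \<forall>g. g \<notin> carrier P \<longrightarrow> f g = 0},
     mult = (\<lambda>f h g. if g \<in> carrier P
               then (\<Sum>x\<in>carrier P. f x * h (inv\<^bsub>P\<^esub> x \<otimes>\<^bsub>P\<^esub> g)) else 0),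
     one = (\<lambda>g. if g = \<one>\<^bsub>P\<^esub> then 1 else 0),
     zero = (\<lambda>g. 0),
     add = (\<lambda>f h g. f g + h g),
     smult = (\<lambda>c f g. c * f g)\<rparr>"

text \<open>
  A restricted Lie algebra is represented by the same kind of record, extended by the
  \<open>p\<close>-power operation.  The field \<^const>\<open>mult\<close> holds the Lie bracket; the field
  \<^const>\<open>one\<close> is meaningless for a Lie algebra, is always set to \<open>zero\<close>, and is never used.
\<close>

record ('k, 'a) restricted_lie = "('k, 'a) module" +
  p_power :: "'a \<Rightarrow> 'a"

definition derivations :: "('k::field, 'a, 'c) module_scheme \<Rightarrow> ('a \<Rightarrow> 'a) set" where
  "derivations A =
    {D \<in> carrier A \<rightarrow>\<^sub>E carrier A.
       (\<forall>x\<in>carrier A. \<forall>y\<in>carrier A. D (x \<oplus>\<^bsub>A\<^esub> y) = D x \<oplus>\<^bsub>A\<^esub> D y) \<and>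
       (\<forall>c. \<forall>x\<in>carrier A. D (c \<odot>\<^bsub>A\<^esub> x) = c \<odot>\<^bsub>A\<^esub> D x) \<and>
       (\<forall>x\<in>carrier A. \<forall>y\<in>carrier A.
          D (x \<otimes>\<^bsub>A\<^esub> y) = (D x \<otimes>\<^bsub>A\<^esub> y) \<oplus>\<^bsub>A\<^esub> (x \<otimes>\<^bsub>A\<^esub> D y))}"

definition inner_derivations :: "('k::field, 'a, 'c) module_scheme \<Rightarrow> ('a \<Rightarrow> 'a) set" where
  "inner_derivations A =
    (\<lambda>a. \<lambda>x\<in>carrier A. (a \<otimes>\<^bsub>A\<^esub> x) \<ominus>\<^bsub>A\<^esub> (x \<otimes>\<^bsub>A\<^esub> a)) ` carrier A"

definition Der :: "('k::field, 'a, 'c) module_scheme \<Rightarrow> ('k, 'a \<Rightarrow> 'a) restricted_lie" where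
  "Der A =
    \<lparr>carrier = derivations A,
     mult = (\<lambda>D E. \<lambda>x\<in>carrier A. D (E x) \<ominus>\<^bsub>A\<^esub> E (D x)),
     one = (\<lambda>x\<in>carrier A. \<zero>\<^bsub>A\<^esub>),
     zero = (\<lambda>x\<in>carrier A. \<zero>\<^bsub>A\<^esub>),
     add = (\<lambda>D E. \<lambda>x\<in>carrier A. D x \<oplus>\<^bsub>A\<^esub> E x),
     smult = (\<lambda>c D. \<lambda>x\<in>carrier A. c \<odot>\<^bsub>A\<^esub> D x),
     p_power = (\<lambda>D. \<lambda>x\<in>carrier A. (D ^^ CHAR('k)) x)\<rparr>"

text \<open>
  The quotient by a restricted ideal, with cosets as elements.  As for \<^const>\<open>FactRing\<close>, the
  operations on cosets are unions over all representatives, so that no choice is involved.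
\<close>

definition restricted_lie_quotient ::
    "('k::field, 'a) restricted_lie \<Rightarrow> 'a set \<Rightarrow> ('k, 'a set) restricted_lie" where
  "restricted_lie_quotient L I =
    \<lparr>carrier = a_rcosets\<^bsub>L\<^esub> I,
     mult = rcoset_mult L I,
     one = I,
     zero = I,
     add = set_add L,
     smult = (\<lambda>c X. \<Union>x\<in>X. I +>\<^bsub>L\<^esub> (c \<odot>\<^bsub>L\<^esub> x)),
     p_power = (\<lambda>X. \<Union>x\<in>X. I +>\<^bsub>L\<^esub> p_power L x)\<rparr>"

definition HH1 :: "('k::field, 'a, 'c) module_scheme \<Rightarrow> ('k, ('a \<Rightarrow> 'a) set) restricted_lie" where
  "HH1 A = restricted_lie_quotient (Der A) (inner_derivations A)"

definition restricted_subalgebra :: "('k::field, 'a) restricted_lie \<Rightarrow> 'a set \<Rightarrow> bool" where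
  "restricted_subalgebra L S \<longleftrightarrow>
     S \<subseteq> carrier L \<and> \<zero>\<^bsub>L\<^esub> \<in> S \<and>
     (\<forall>x\<in>S. \<forall>y\<in>S. x \<oplus>\<^bsub>L\<^esub> y \<in> S) \<and>
     (\<forall>c. \<forall>x\<in>S. c \<odot>\<^bsub>L\<^esub> x \<in> S) \<and>
     (\<forall>x\<in>S. \<forall>y\<in>S. x \<otimes>\<^bsub>L\<^esub> y \<in> S) \<and>
     (\<forall>x\<in>S. p_power L x \<in> S)"

definition restricted_subalgebra_generated ::
    "('k::field, 'a) restricted_lie \<Rightarrow> 'a set \<Rightarrow> 'a set" where
  "restricted_subalgebra_generated L X = \<Inter>{S. restricted_subalgebra L S \<and> X \<subseteq> S}"

definition semisimple_elem :: "('k::field, 'a) restricted_lie \<Rightarrow> 'a \<Rightarrow> bool" where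
  "semisimple_elem L x \<longleftrightarrow> x \<in> restricted_subalgebra_generated L {p_power L x}"

definition torus :: "('k::field, 'a) restricted_lie \<Rightarrow> 'a set \<Rightarrow> bool" where
  "torus L T \<longleftrightarrow>
     restricted_subalgebra L T \<and>
     (\<forall>x\<in>T. \<forall>y\<in>T. x \<otimes>\<^bsub>L\<^esub> y = \<zero>\<^bsub>L\<^esub>) \<and>
     (\<forall>x\<in>T. semisimple_elem L x)"

text \<open>
  Linear algebra over \<open>'k\<close> inside a record.  The locale \<^locale>\<open>vector_space\<close> needs the vectors to
  form a whole type, which the cosets in a quotient do not; the dimension is therefore defined
  here, in the same way as in that locale.
\<close>

definition lin_comb :: "('k::field, 'a, 'c) module_scheme \<Rightarrow> ('a \<Rightarrow> 'k) \<Rightarrow> 'a set \<Rightarrow> 'a" where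
  "lin_comb V c F = (\<Oplus>\<^bsub>V\<^esub>x\<in>F. c x \<odot>\<^bsub>V\<^esub> x)"

definition lin_independent :: "('k::field, 'a, 'c) module_scheme \<Rightarrow> 'a set \<Rightarrow> bool" where
  "lin_independent V B \<longleftrightarrow>
     (\<forall>F c. finite F \<and> F \<subseteq> B \<and> lin_comb V c F = \<zero>\<^bsub>V\<^esub> \<longrightarrow> (\<forall>x\<in>F. c x = 0))"

definition lin_span :: "('k::field, 'a, 'c) module_scheme \<Rightarrow> 'a set \<Rightarrow> 'a set" where
  "lin_span V B = {lin_comb V c F | c F. finite F \<and> F \<subseteq> B}"

definition is_basis :: "('k::field, 'a, 'c) module_scheme \<Rightarrow> 'a set \<Rightarrow> 'a set \<Rightarrow> bool" where
  "is_basis V W B \<longleftrightarrow> B \<subseteq> carrier V \<and> lin_independent V B \<and> lin_span V B = W"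

definition subspace_dim :: "('k::field, 'a, 'c) module_scheme \<Rightarrow> 'a set \<Rightarrow> nat" where
  "subspace_dim V W = card (SOME B. is_basis V W B)"

definition mt_rank :: "('k::field, 'a) restricted_lie \<Rightarrow> nat" where
  "mt_rank L = Max {subspace_dim L T | T. torus L T}"

definition min_num_generators :: "('g, 'b) monoid_scheme \<Rightarrow> nat" where
  "min_num_generators P =
     (LEAST n. \<exists>S. S \<subseteq> carrier P \<and> finite S \<and> card S = n \<and> generate P S = carrier P)"

end

theory Submission
  imports Defs "HOL-Algebra.Group_Action" "HOL-Algebra.Elementary_Groups"
    "HOL-Library.Function_Algebras"
begin

text \<open>The obstacle is that every hypothesis on a torus holds only modulo inner derivations: a
  representative of a semisimple class need not be diagonalisable, and representatives of two
  commuting classes need not commute. They are corrected by p-polynomials because those turn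
  derivations into derivations. The exponent |P| is the dimension of kP. It bounds the multiplicity
  of each root of an annihilating polynomial of a vector, and as it is a power of p, the Frobenius
  map turns these roots into simple ones. Write I for the augmentation ideal. The span of 1 and all
  (g - 1)(h - 1) is k1 + I^2, and I is spanned modulo I^2 by the elements s - 1 with s in a
  generating set; this is where the number of generators enters the upper bound. Fixed points are
  found by counting, while k is infinite; hence the restriction to coefficients in the prime field.
  A functional is recorded only by its values on the bimodule generated by the image of the
  derivation, so that a nonzero fixed point cannot vanish there.\<close>

text \<open>
  Every element of \<open>HH\<^sup>1(kP)\<close> lying in a torus is represented by a \<open>p\<close>-polynomial in some \<open>D\<close>
  all of whose terms are powers of \<open>D ^ \<bar>P\<bar>\<close>, hence by a diagonalisable derivation;
  as a diagonalisable \<open>E\<close> satisfies a \<open>p\<close>-polynomial identity with nonzero linear term, representatives can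
  be moved into the centraliser of \<open>E\<close> modulo inner derivations, so a basis of the torus lifts to commuting
  diagonalisable derivations.  Their common eigenvectors span \<open>kP\<close>; with \<open>d\<close> the minimal number of generators,
  \<open>d\<close> of them span \<open>kP\<close> together with \<open>1\<close> and all \<open>(g - 1)(h - 1)\<close>.  A derivation killing those vanishes:
  otherwise there is a nonzero \<open>P \<times> P\<close>-invariant functional on the bimodule generated by its image, because a
  \<open>p\<close>-group has nonzero fixed points on a nonzero finite \<open>\<bbbF>\<^sub>p\<close>-space, and its composition with
  the derivation kills all products of augmentation elements.  So a torus has dimension at most \<open>d\<close>.
  Conversely the derivations \<open>g \<mapsto> f(g) g\<close>, with \<open>f\<close> an additive character \<open>P \<rightarrow> k\<close>, give a torus, and
  it has dimension at least \<open>d\<close> because a proper subgroup of \<open>P\<close> is killed by a nonzero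
  additive character, by the same fixed point argument.
\<close>

section \<open>Linear endomorphisms in characteristic \<open>p\<close>\<close>

text \<open>Gaussian elimination, one equation \<open>y\<close> at a time, with \<open>M x y\<close>
  the coefficient of the unknown \<open>x\<close>. It yields both the annihilating polynomial of a
  vector and the combination of lifted derivations whose eigenvalues on given vectors all
  vanish.\<close>

lemma homogeneous_system:
  fixes M :: "'x \<Rightarrow> 'y \<Rightarrow> 'k::field"
  assumes "finite Y" "finite X" "card Y < card X"
  shows "\<exists>c. (\<exists>x\<in>X. c x \<noteq> 0) \<and> (\<forall>y\<in>Y. (\<Sum>x\<in>X. c x * M x y) = 0)"
  using assms
proof (induction Y arbitrary: X M rule: finite_induct)
  case empty
  then have "X \<noteq> {}" by auto
  then show ?case by (intro exI[of _ "\<lambda>_. 1"]) auto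
next
  case (insert y Y)
  show ?case
  proof (cases "\<forall>x\<in>X. M x y = 0")
    case True
    obtain c where "\<exists>x\<in>X. c x \<noteq> 0" "\<forall>y\<in>Y. (\<Sum>x\<in>X. c x * M x y) = 0"
      using insert.IH[of X M] insert.prems insert.hyps by auto
    with True show ?thesis by (intro exI[of _ c]) simp
  next
    case False
    then obtain x0 where x0: "x0 \<in> X" "M x0 y \<noteq> 0" by auto
    define X' where "X' = X - {x0}"
    \<comment> \<open>The system after eliminating the pivot unknown \<open>x0\<close> by means of
      equation \<open>y\<close>; the value of \<open>c' x0\<close> below is the one that equation
      \<open>y\<close> forces.\<close>
    define M' where "M' = (\<lambda>x z. M x z - M x y / M x0 y * M x0 z)"
    have X: "finite X'" "x0 \<notin> X'" "X = insert x0 X'"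
      using insert.prems x0 by (auto simp: X'_def)
    have "card Y < card X'"
      using insert.prems insert.hyps X by simp
    then obtain c where c: "\<exists>x\<in>X'. c x \<noteq> 0" "\<forall>y\<in>Y. (\<Sum>x\<in>X'. c x * M' x y) = 0"
      using insert.IH[of X' M'] X by blast
    define s where "s = (\<Sum>x\<in>X'. c x * M x y)"
    define c' where "c' = c(x0 := - s / M x0 y)"
    have c': "c' x0 = - s / M x0 y" "\<And>x. x \<in> X' \<Longrightarrow> c' x = c x"
      using X by (auto simp: c'_def)
    have sum: "(\<Sum>x\<in>X. c' x * M x z) = - s / M x0 y * M x0 z + (\<Sum>x\<in>X'. c x * M x z)" for z
      using X c' by simp
    have "(\<Sum>x\<in>X. c' x * M x z) = 0" if "z \<in> insert y Y" for z
    proof (cases "z = y")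
      case True
      then show ?thesis using x0 by (simp add: sum s_def)
    next
      case False
      with that have "(\<Sum>x\<in>X'. c x * M' x z) = 0" using c by auto
      then have "(\<Sum>x\<in>X'. c x * M x z) = (\<Sum>x\<in>X'. c x * M x y * (M x0 z / M x0 y))"
        by (simp add: M'_def right_diff_distrib sum_subtractf mult_ac)
      then show ?thesis
        by (simp add: sum s_def sum_distrib_right sum_divide_distrib sum_negf)
    qed
    moreover have "\<exists>x\<in>X. c' x \<noteq> 0" using c c' X by auto
    ultimately show ?thesis by blast
  qed
qed

locale endomorphisms = vector_space
begin

abbreviation endo :: "('b \<Rightarrow> 'b) \<Rightarrow> bool" where
  "endo \<equiv> Vector_Spaces.linear scale scale"

lemma endo_iff:
  "endo E \<longleftrightarrow> (\<forall>x y. E (x + y) = E x + E y) \<and> (\<forall>c x. E (c *s x) = c *s E x)"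
  using vector_space_axioms by (simp add: Vector_Spaces.linear_iff)

lemma endo_module_hom: "endo E \<Longrightarrow> module_hom scale scale E"
  by (simp add: module_hom_iff_linear)

lemmas endo_add = module_hom.add[OF endo_module_hom]
  and endo_scale = module_hom.scale[OF endo_module_hom]
  and endo_zero = module_hom.zero[OF endo_module_hom]
  and endo_diff = module_hom.diff[OF endo_module_hom]
  and endo_sum = module_hom.sum[OF endo_module_hom]

lemma endo_funpow: "endo E \<Longrightarrow> endo (E ^^ n)"
  by (induction n) (auto simp: endo_iff)

text \<open>The two arguments of \<open>B\<close> carry their own operators \<open>V\<close> and
  \<open>W\<close>. This covers twisted derivations, where left and right factor are treated
  differently, and also evaluation \<open>B F x = F x\<close>, where \<open>V\<close> is a
  commutator. The induction step is Pascal's rule.\<close>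

lemma Leibniz:
  assumes E: "endo E"
    and EB: "\<And>x y. x \<in> X \<Longrightarrow> y \<in> Y \<Longrightarrow> E (B x y) = B (V x) y + B x (W y)"
    and V: "\<And>x. x \<in> X \<Longrightarrow> V x \<in> X" and W: "\<And>y. y \<in> Y \<Longrightarrow> W y \<in> Y"
    and "x \<in> X" "y \<in> Y"
  shows "(E ^^ n) (B x y) = (\<Sum>i\<le>n. of_nat (n choose i) *s B ((V ^^ i) x) ((W ^^ (n - i)) y))"
proof (induction n)
  case 0
  then show ?case by simp
next
  case (Suc n)
  have Vn: "(V ^^ i) x \<in> X" for i using \<open>x \<in> X\<close> V by (induction i) auto
  have Wn: "(W ^^ i) y \<in> Y" for i using \<open>y \<in> Y\<close> W by (induction i) auto
  define b where "b i j = B ((V ^^ i) x) ((W ^^ j) y)" for i j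
  have Eb: "E (b i j) = b (Suc i) j + b i (Suc j)" for i j
    using EB[OF Vn Wn] by (simp add: b_def)
  have "(E ^^ Suc n) (B x y) = (\<Sum>i\<le>n. of_nat (n choose i) *s (b (Suc i) (n - i) + b i (Suc (n - i))))"
    by (simp add: Suc.IH endo_sum[OF E] endo_scale[OF E] Eb flip: b_def)
  also have "\<dots> = (\<Sum>i\<le>n. of_nat (n choose i) *s b (Suc i) (n - i))
      + (\<Sum>i\<le>n. of_nat (n choose i) *s b i (Suc n - i))"
    by (simp add: scale_right_distrib sum.distrib Suc_diff_le)
  also have "(\<Sum>i\<le>n. of_nat (n choose i) *s b i (Suc n - i))
      = (\<Sum>i\<le>Suc n. of_nat (n choose i) *s b i (Suc n - i))"
    by (simp add: binomial_eq_0)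
  also have "\<dots> = b 0 (Suc n) + (\<Sum>i\<le>n. of_nat (n choose Suc i) *s b (Suc i) (n - i))"
    by (subst sum.atMost_Suc_shift) simp
  also have "(\<Sum>i\<le>n. of_nat (n choose i) *s b (Suc i) (n - i)) + \<dots>
      = b 0 (Suc n) + (\<Sum>i\<le>n. of_nat (Suc n choose Suc i) *s b (Suc i) (n - i))"
    by (simp add: sum.distrib[symmetric] scale_left_distrib[symmetric] add_ac)
  also have "\<dots> = (\<Sum>i\<le>Suc n. of_nat (Suc n choose i) *s b i (Suc n - i))"
    by (subst sum.atMost_Suc_shift) simp
  finally show ?case by (simp add: b_def)
qed

text \<open>All binomial coefficients except the two outer ones are divisible by
  \<open>p\<close>.\<close>

lemma Leibniz_CHAR:
  assumes "endo E"
    and "\<And>x y. x \<in> X \<Longrightarrow> y \<in> Y \<Longrightarrow> E (B x y) = B (V x) y + B x (W y)"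
    and "\<And>x. x \<in> X \<Longrightarrow> V x \<in> X" and "\<And>y. y \<in> Y \<Longrightarrow> W y \<in> Y"
    and "x \<in> X" "y \<in> Y"
    and p: "prime p" "CHAR('a) = p"
  shows "(E ^^ p) (B x y) = B ((V ^^ p) x) y + B x ((W ^^ p) y)"
proof -
  define f where "f i = of_nat (p choose i) *s B ((V ^^ i) x) ((W ^^ (p - i)) y)" for i
  have p0: "p > 0" using p by (simp add: prime_gt_0_nat)
  have "f i = 0" if "i \<in> {..p} - {0, p}" for i
  proof -
    have "p dvd p choose i" using that p by (intro dvd_choose_prime) (use p0 p(1) in auto)
    then have "(of_nat (p choose i) :: 'a) = 0" using p(2) by (simp add: of_nat_eq_0_iff_char_dvd)
    then show ?thesis by (simp add: f_def)
  qed
  then have "(\<Sum>i\<le>p. f i) = (\<Sum>i\<in>{0, p}. f i)"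
    by (intro sum.mono_neutral_right) auto
  also have "\<dots> = f 0 + f p" using p0 by simp
  finally show ?thesis
    using Leibniz[where n = p and E = E and B = B and V = V and W = W, OF assms(1-6)] by (simp add: f_def)
qed

section \<open>Polynomials in an endomorphism and its eigenvectors\<close>

definition act :: "('b \<Rightarrow> 'b) \<Rightarrow> 'a poly \<Rightarrow> 'b \<Rightarrow> 'b" where
  "act E h v = (\<Sum>i\<le>degree h. coeff h i *s (E ^^ i) v)"

lemma act_upto:
  assumes "degree h \<le> n"
  shows "act E h v = (\<Sum>i\<le>n. coeff h i *s (E ^^ i) v)"
  unfolding act_def using assms
  by (intro sum.mono_neutral_left) (auto simp: coeff_eq_0)

lemma act_0 [simp]: "act E 0 v = 0"
  by (simp add: act_def)

lemma act_add: "act E (f + g) v = act E f v + act E g v"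
proof -
  define n where "n = max (degree f) (degree g)"
  have "degree (f + g) \<le> n" by (simp add: n_def degree_add_le_max)
  then show ?thesis
    by (subst (1 2 3) act_upto[of _ n])
       (auto simp: n_def scale_left_distrib sum.distrib)
qed

lemma act_smult: "act E (Polynomial.smult c f) v = c *s act E f v"
  by (subst (1 2) act_upto[of _ "degree f"]) (auto simp: scale_sum_right degree_smult_le)

lemma act_monom: "act E (monom c n) v = c *s (E ^^ n) v"
proof -
  have "act E (monom c n) v = (\<Sum>i\<le>n. (if i = n then c *s (E ^^ n) v else 0))"
    by (rule trans[OF act_upto[OF degree_monom_le]]) (rule sum.cong, auto)
  then show ?thesis by simp
qed

lemma act_pCons:
  assumes "endo E"
  shows "act E (pCons a h) v = a *s v + E (act E h v)"
proof -
  have "act E (pCons a h) v = (\<Sum>i\<le>Suc (degree h). coeff (pCons a h) i *s (E ^^ i) v)"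
    by (rule act_upto) (simp add: degree_pCons_le)
  also have "\<dots> = a *s v + (\<Sum>i\<le>degree h. coeff h i *s (E ^^ Suc i) v)"
    by (subst sum.atMost_Suc_shift) simp
  also have "\<dots> = a *s v + E (act E h v)"
    by (simp add: act_def endo_sum[OF assms] endo_scale[OF assms])
  finally show ?thesis .
qed

lemma endo_act: "endo E \<Longrightarrow> endo (act E h)"
  by (induction h) (auto simp: act_pCons endo_iff scale_right_distrib mult.commute add_ac)

lemma act_mult:
  assumes "endo E"
  shows "act E (f * g) v = act E f (act E g v)"
proof (induction f)
  case 0
  then show ?case by simp
next
  case (pCons a f)
  then show ?case
    by (simp add: act_pCons[OF assms] act_add act_smult)
qed

lemma act_1 [simp]: "act E 1 v = v"
  using act_monom[of E 1 0 v] by (simp add: monom_0 flip: one_pCons)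

lemma act_power:
  assumes "endo E"
  shows "act E (f ^ n) v = (act E f ^^ n) v"
  by (induction n) (simp_all add: act_mult[OF assms])

lemma act_eigenvector:
  assumes "endo E" "E v = l *s v"
  shows "act E h v = poly h l *s v"
  by (induction h)
     (simp_all add: act_pCons[OF assms(1)] endo_scale[OF assms(1)] assms(2) scale_left_distrib mult.commute)

lemma act_linear_factor:
  assumes "endo E"
  shows "act E [:-l, 1:] v = E v - l *s v"
  by (simp add: act_pCons[OF assms] endo_zero[OF assms])

lemma act_commute:
  assumes "endo E" "endo F" "\<And>v. F (E v) = E (F v)"
  shows "F (act E h v) = act E h (F v)"
  by (induction h)
     (simp_all add: act_pCons[OF assms(1)] endo_add[OF assms(2)] endo_scale[OF assms(2)]
       endo_zero[OF assms(2)] assms(3))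

text \<open>Induction on the roots: \<open>w = E v - m v\<close> is a sum of eigenvectors for the
  other roots \<open>n\<close>, on each of which \<open>E - m\<close> acts as the invertible scalar
  \<open>n - m\<close>. So \<open>w\<close> is the image under \<open>E - m\<close> of such a sum
  \<open>u\<close>, and \<open>v - u\<close> is an eigenvector for \<open>m\<close>. The hypothesis
  concerns the single vector \<open>v\<close>, since the annihilating polynomials found later depend
  on the vector.\<close>

lemma span_eigenvectors_if_act_eq_0:
  assumes E: "endo E" and S: "subspace S" "\<And>v. v \<in> S \<Longrightarrow> E v \<in> S"
    and "finite M" "v \<in> S" "act E (\<Prod>m\<in>M. [:-m, 1:]) v = 0"
  shows "v \<in> span {u \<in> S. \<exists>m\<in>M. E u = m *s u}"
  using assms(4-)
proof (induction M arbitrary: v rule: finite_induct)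
  case empty
  then show ?case by (simp add: span_zero)
next
  case (insert m M)
  define w where "w = E v - m *s v"
  have wS: "w \<in> S" using insert.prems S by (simp add: w_def subspace_diff subspace_scale)
  have "act E ((\<Prod>m\<in>M. [:-m, 1:]) * [:-m, 1:]) v = 0"
    using insert.prems(2) unfolding prod.insert[OF insert.hyps] by (simp only: mult.commute)
  then have "act E (\<Prod>m\<in>M. [:-m, 1:]) w = 0"
    unfolding act_mult[OF E] act_linear_factor[OF E] w_def .
  then have w: "w \<in> span {u \<in> S. \<exists>m\<in>M. E u = m *s u}"
    using insert.IH wS by blast
  let ?R = "{u \<in> S. \<exists>n\<in>M. E u = n *s u}"
  have "\<exists>u\<in>span ?R. E u - m *s u = w"
    using w
  proof (induction rule: span_induct_alt)
    case base
    then show ?case by (intro bexI[of _ 0]) (auto simp: span_zero endo_zero[OF E])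
  next
    case (step c x y)
    then obtain u n where u: "u \<in> span ?R" "E u - m *s u = y" and n: "n \<in> M" "E x = n *s x" "x \<in> S"
      by auto
    have nm: "n - m \<noteq> 0" using n insert.hyps by auto
    have "E (u + (c / (n - m)) *s x) - m *s (u + (c / (n - m)) *s x)
        = (E u - m *s u) + (c / (n - m)) *s ((n - m) *s x)"
      by (simp only: endo_add[OF E] endo_scale[OF E] n)
         (simp add: algebra_simps)
    also have "\<dots> = c *s x + y" using nm u by (simp add: add.commute)
    finally show ?case
      using u(1) n by (intro bexI[of _ "u + (c / (n - m)) *s x"]) (auto intro!: span_add span_scale intro: span_base)
  qed
  then obtain u where u: "u \<in> span ?R" "E u - m *s u = w" by auto
  have sub: "?R \<subseteq> {u \<in> S. \<exists>n\<in>insert m M. E u = n *s u}" by auto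
  have "u \<in> S" using u span_minimal[of ?R S] S by auto
  moreover have "E (v - u) = m *s (v - u)"
    using u by (simp add: endo_diff[OF E] w_def scale_right_diff_distrib algebra_simps)
  ultimately have "v - u \<in> span {u \<in> S. \<exists>n\<in>insert m M. E u = n *s u}"
    using insert.prems S by (intro span_base) (auto simp: subspace_diff)
  moreover have "u \<in> span {u \<in> S. \<exists>n\<in>insert m M. E u = n *s u}"
    using u span_mono[OF sub] by auto
  ultimately show ?case using span_add by fastforce
qed

lemma act_eq_0_if_span_eigenvectors:
  assumes E: "endo E" and "finite M" "v \<in> span {u. \<exists>m\<in>M. E u = m *s u}"
  shows "act E (\<Prod>m\<in>M. [:-m, 1:]) v = 0"
  using assms(3)
proof (induction rule: span_induct_alt)
  case base
  then show ?case by (rule endo_zero[OF endo_act[OF E]])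
next
  case (step c x y)
  then obtain m where m: "m \<in> M" "E x = m *s x" by auto
  have "poly (\<Prod>m\<in>M. [:-m, 1:]) m = 0"
    using m assms by (auto simp: poly_prod)
  then have "act E (\<Prod>m\<in>M. [:-m, 1:]) x = 0"
    using act_eigenvector[OF E m(2)] by simp
  then show ?case using step endo_act[OF E] by (simp add: endo_add endo_scale)
qed

end

section \<open>\<open>p\<close>-polynomials\<close>

text \<open>Linear combinations of the monomials x^(p^i) with \<open>N \<le> i\<close>. Two lower
  bounds matter: \<open>N = 1\<close> excludes the linear term, and \<open>N = n\<close> with |P| =
  p^n leaves only powers of x^|P|.\<close>

inductive_set p_polys :: "nat \<Rightarrow> nat \<Rightarrow> 'k::comm_ring_1 poly set" for p N where
  zero: "0 \<in> p_polys p N"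
| step: "h \<in> p_polys p N \<Longrightarrow> N \<le> i \<Longrightarrow> h + monom c (p ^ i) \<in> p_polys p N"

lemma p_polys_add:
  assumes "f \<in> p_polys p N" "g \<in> p_polys p N"
  shows "f + g \<in> p_polys p N"
  using assms(2)
proof (induction rule: p_polys.induct)
  case zero
  then show ?case using assms(1) by simp
next
  case (step h i c)
  then show ?case using p_polys.step[of "f + h" p N i c] by (simp add: add.assoc)
qed

lemma p_polys_smult: "f \<in> p_polys p N \<Longrightarrow> Polynomial.smult c f \<in> p_polys p N"
  by (induction rule: p_polys.induct) (auto simp: smult_add_right smult_monom intro: p_polys.intros)

lemma p_polys_monom: "N \<le> i \<Longrightarrow> monom c (p ^ i) \<in> p_polys p N"
  using p_polys.step[OF p_polys.zero, of N i c p] by simp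

lemma p_polys_antimono: "f \<in> p_polys p N \<Longrightarrow> M \<le> N \<Longrightarrow> f \<in> p_polys p M"
  by (induction rule: p_polys.induct) (auto intro: p_polys.intros)

text \<open>Frobenius is additive, so the \<open>p\<close>-th power acts termwise and raises every
  exponent by one level; the bound \<open>N\<close> thus counts applications of the
  \<open>p\<close>-power operation.\<close>

lemma p_polys_power:
  fixes f :: "'k::field poly"
  assumes "f \<in> p_polys p N" and p: "prime p" "CHAR('k) = p"
  shows "f ^ p \<in> p_polys p (Suc N)"
  using assms(1)
proof (induction rule: p_polys.induct)
  case zero
  have "p > 0" using p(1) by (simp add: prime_gt_0_nat)
  then show ?case by (simp add: p_polys.zero power_0_left)
next
  case (step h i c)
  have "(h + monom c (p ^ i)) ^ p = h ^ p + monom c (p ^ i) ^ p"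
    by (rule freshmans_dream) (use p in auto)
  also have "monom c (p ^ i) ^ p = monom (c ^ p) (p ^ Suc i)"
    by (simp add: monom_power mult.commute)
  finally have "(h + monom c (p ^ i)) ^ p = h ^ p + monom (c ^ p) (p ^ Suc i)" .
  then show ?case using p_polys.step[OF step.IH, of "Suc i" "c ^ p"] step.hyps by simp
qed

text \<open>With \<open>L\<close> the set of eigenvalues of a diagonalisable map, x - h(x) is the
  \<open>p\<close>-polynomial with nonzero linear term that annihilates the map.\<close>

lemma p_polys_interpolate_id:
  fixes L :: "'k::field set"
  assumes "finite L" and p: "prime p" "CHAR('k) = p"
  shows "\<exists>h\<in>p_polys p 1. \<forall>l\<in>L. poly h l = l"
  using assms(1)
proof (induction L rule: finite_induct)
  case empty
  then show ?case using p_polys.zero by blast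
next
  case (insert c L)
  then obtain h where h: "h \<in> p_polys p 1" "\<forall>l\<in>L. poly h l = l" by blast
  define r where "r = c - poly h c"
  show ?case
  proof (cases "r = 0")
    case True
    then show ?thesis using h by (intro bexI[of _ h]) (auto simp: r_def)
  next
    case False
    \<comment> \<open>The polynomial x^p - h^p vanishes wherever h(x) = x, hence on
      \<open>L\<close>, and by additivity of Frobenius takes the value \<open>r ^ p\<close> at
      \<open>c\<close>. Adding its multiple by \<open>d\<close> repairs the error \<open>r\<close>
      at \<open>c\<close> and changes nothing on \<open>L\<close>.\<close>
    define d where "d = r / r ^ p"
    define g where "g = h + Polynomial.smult d (monom 1 (p ^ 1) + Polynomial.smult (- 1) (h ^ p))"
    have "h ^ p \<in> p_polys p 1"
      using p_polys_antimono[OF p_polys_power[OF h(1) p]] by simp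
    then have g_mem: "g \<in> p_polys p 1" unfolding g_def
      by (intro p_polys_add p_polys_smult p_polys_monom h) auto
    have g: "poly g l = poly h l + d * (l ^ p - poly h l ^ p)" for l
      by (simp add: g_def poly_monom)
    have "poly g l = l" if "l \<in> L" for l
      using h(2) that by (simp add: g)
    moreover have "poly g c = c"
    proof -
      have "(r + poly h c) ^ p = r ^ p + poly h c ^ p"
        by (rule freshmans_dream) (use p in auto)
      moreover have "r + poly h c = c" by (simp add: r_def)
      ultimately have "c ^ p = r ^ p + poly h c ^ p" by metis
      then have "poly g c = poly h c + d * r ^ p" by (simp add: g)
      also have "d * r ^ p = r" using False by (simp add: d_def)
      finally show ?thesis by (simp add: r_def)
    qed
    ultimately show ?thesis using g_mem by (intro bexI[of _ g]) auto
  qed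
qed

lemma inj_power_char:
  fixes x y :: "'k::field"
  assumes p: "prime p" "CHAR('k) = p" and eq: "x ^ (p ^ n) = y ^ (p ^ n)"
  shows "x = y"
proof -
  have "x ^ (p ^ n) = ((x - y) + y) ^ (p ^ n)" by simp
  also have "\<dots> = (x - y) ^ (p ^ n) + y ^ (p ^ n)"
    by (rule freshmans_dream') (use p in auto)
  finally show ?thesis using eq by simp
qed

text \<open>A factor of multiplicity \<open>p ^ n\<close> in x is a simple factor in x^(p^n). This
  is how multiple roots for \<open>F\<close> become simple roots for its \<open>p ^ n\<close>-th
  power.\<close>

lemma linear_factor_power_char:
  fixes l :: "'k::field"
  assumes p: "prime p" "CHAR('k) = p"
  shows "[:- l, 1:] ^ (p ^ n) = pcompose [:- (l ^ (p ^ n)), 1:] (monom 1 (p ^ n))"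
proof -
  have q: "p ^ n > 0" using p by (simp add: prime_gt_0_nat)
  have "0 = (l + - l) ^ (p ^ n)" using q by simp
  also have "\<dots> = l ^ (p ^ n) + (- l) ^ (p ^ n)"
    by (rule freshmans_dream') (use p in auto)
  finally have neg: "(- l) ^ (p ^ n) = - (l ^ (p ^ n))" by (metis minus_unique)
  have "[:- l, 1:] ^ (p ^ n) = ([:- l:] + monom 1 1) ^ (p ^ n)"
    by (simp add: monom_altdef)
  also have "\<dots> = [:- l:] ^ (p ^ n) + monom 1 1 ^ (p ^ n)"
    by (rule freshmans_dream') (use p in auto)
  also have "\<dots> = [:- (l ^ (p ^ n)):] + monom 1 (p ^ n)"
    by (simp add: monom_power neg poly_const_pow)
  finally show ?thesis by (simp add: pcompose_pCons)
qed

lemma (in endomorphisms) act_funpow: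
  assumes E: "endo E"
  shows "act (E ^^ q) h v = act E (pcompose h (monom 1 q)) v"
  by (induction h)
     (simp_all add: act_pCons[OF endo_funpow[OF E]] pcompose_pCons act_add act_mult[OF E] act_monom
       act_pCons[OF E] endo_zero[OF E])

text \<open>All multiplicities are raised to the common bound \<open>q\<close>, so that, for
  \<open>q\<close> a power of the characteristic, the product becomes a polynomial in x^q with
  simple roots.\<close>

lemma dvd_prod_linear_factors:
  fixes f :: "'k::alg_closed_field poly"
  assumes "f \<noteq> 0" "degree f \<le> q"
  obtains R where "finite R" "f dvd (\<Prod>l\<in>R. [:- l, 1:] ^ q)"
proof -
  obtain X where X: "size X = degree f" "f = Polynomial.smult (lead_coeff f) (\<Prod>x\<in>#X. [:-x, 1:])"
    using alg_closed_imp_factorization[OF assms(1)] by blast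
  have "(\<Prod>x\<in>#X. [:-x, 1:]) = (\<Prod>x\<in>set_mset X. [:-x, 1:] ^ count X x)"
    by (rule image_prod_mset_multiplicity)
  also have "\<dots> dvd (\<Prod>x\<in>set_mset X. [:-x, 1:] ^ q)"
    using X(1) assms(2) count_le_size[of X] by (intro prod_dvd_prod le_imp_power_dvd) (auto intro: order_trans)
  finally have "f dvd (\<Prod>x\<in>set_mset X. [:-x, 1:] ^ q)"
    using X(2) assms(1) by (metis leading_coeff_0_iff smult_dvd)
  then show thesis using that by blast
qed

section \<open>Fixed points of \<open>p\<close>-groups\<close>

text \<open>Every orbit has \<open>p\<close>-power size by orbit and stabiliser, and those outside
  the fixed points have more than one element; they partition the rest of \<open>X\<close>. The map
  \<open>f\<close> is constrained on \<open>X\<close> only, so the action proper is its restriction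
  \<open>phi\<close>.\<close>

lemma p_group_card_fixed_points:
  assumes "group G" and G: "finite (carrier G)" "Coset.order G = p ^ n" and p: "prime p" and "finite X"
    and closed: "\<And>g x. g \<in> carrier G \<Longrightarrow> x \<in> X \<Longrightarrow> f g x \<in> X"
    and one: "\<And>x. x \<in> X \<Longrightarrow> f \<one>\<^bsub>G\<^esub> x = x"
    and mult: "\<And>g h x. g \<in> carrier G \<Longrightarrow> h \<in> carrier G \<Longrightarrow> x \<in> X \<Longrightarrow> f (g \<otimes>\<^bsub>G\<^esub> h) x = f g (f h x)"
  shows "card X mod p = card {x \<in> X. \<forall>g\<in>carrier G. f g x = x} mod p"
proof -
  interpret group G by fact
  define phi where "phi g = restrict (f g) X" for g
  define F where "F = {x \<in> X. \<forall>g\<in>carrier G. f g x = x}"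
  have bij: "bij_betw (f g) X X" if "g \<in> carrier G" for g
    by (rule bij_betw_byWitness[where f' = "f (inv\<^bsub>G\<^esub> g)"])
       (use that in \<open>auto simp: closed one mult[symmetric]\<close>)
  have "phi \<in> hom G (BijGroup X)"
    by (auto simp: hom_def BijGroup_def Bij_def phi_def bij mult compose_def closed bij_betw_restrict_eq
        intro!: restrict_ext)
  then interpret act: group_action G X phi
    by (simp add: group_action_def group_hom_def group_hom_axioms_def group_BijGroup)
  have orbit: "orbit G phi x = (\<lambda>g. f g x) ` carrier G" if "x \<in> X" for x
    using that by (auto simp: orbit_def phi_def)
  have self: "x \<in> orbit G phi x" if "x \<in> X" for x
    unfolding orbit[OF that] using one[OF that] by (metis imageI one_closed)
  have dvd: "p dvd card (orbit G phi x)" if x: "x \<in> X - F" for x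
  proof -
    have "card (orbit G phi x) dvd p ^ n"
      using act.orbit_stabilizer_theorem[of x] x G(2) by (metis DiffD1 dvd_triv_left)
    then obtain i where i: "card (orbit G phi x) = p ^ i"
      using p by (metis divides_primepow_nat)
    have "i \<noteq> 0"
    proof
      assume "i = 0"
      then obtain y where "orbit G phi x = {y}" using i by (auto simp: card_1_singleton_iff)
      then have "f g x = x" if "g \<in> carrier G" for g
        using self[of x] orbit[of x] x that by auto
      then show False using x by (simp add: F_def)
    qed
    then show ?thesis using i by simp
  qed
  have sub: "orbit G phi x \<subseteq> X - F" if x: "x \<in> X - F" for x
  proof
    fix y assume "y \<in> orbit G phi x"
    then obtain g where g: "g \<in> carrier G" "y = f g x" using x orbit by auto
    have "y \<notin> F"
    proof
      assume "y \<in> F"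
      then have "f (inv\<^bsub>G\<^esub> g) y = y" using g by (simp add: F_def)
      moreover have "f (inv\<^bsub>G\<^esub> g) y = x"
        using g x one by (simp add: mult[symmetric])
      ultimately show False using \<open>y \<in> F\<close> x by simp
    qed
    then show "y \<in> X - F" using g x closed by simp
  qed
  have "p dvd card (\<Union>x\<in>X - F. orbit G phi x)"
  proof (rule dvd_partition)
    show "finite (\<Union>x\<in>X - F. orbit G phi x)"
      using sub \<open>finite X\<close> by (meson UN_least finite_Diff finite_subset)
    show "\<forall>c\<in>orbit G phi ` (X - F). p dvd card c" using dvd by blast
    have "orbit G phi x = orbit G phi y" if "x \<in> X" "y \<in> X" "orbit G phi x \<inter> orbit G phi y \<noteq> {}" for x y
    proof -
      have "orbit G phi x \<subseteq> orbit G phi y" if x: "x \<in> X" and y: "y \<in> X" and z: "z \<in> orbit G phi x" "z \<in> orbit G phi y" for x y z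
      proof
        fix w assume "w \<in> orbit G phi x"
        obtain g h where gh: "g \<in> carrier G" "z = f g x" "h \<in> carrier G" "z = f h y"
          using z unfolding orbit[OF x] orbit[OF y] by blast
        moreover obtain k where "k \<in> carrier G" "w = f k x"
          using \<open>w \<in> orbit G phi x\<close> unfolding orbit[OF x] by blast
        ultimately have g: "g \<in> carrier G" "z = f g x" "h \<in> carrier G" "z = f h y" "k \<in> carrier G" "w = f k x"
          by blast+
        have "x = f (inv\<^bsub>G\<^esub> g) (f g x)"
          using g x one by (simp add: mult[symmetric])
        then have "w = f (k \<otimes>\<^bsub>G\<^esub> (inv\<^bsub>G\<^esub> g \<otimes>\<^bsub>G\<^esub> h)) y"
          using g y closed by (simp add: mult)
        then show "w \<in> orbit G phi y" using g y by (auto simp: orbit)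
      qed
      then show ?thesis using that by blast
    qed
    then show "\<forall>c1\<in>orbit G phi ` (X - F). \<forall>c2\<in>orbit G phi ` (X - F). c1 \<noteq> c2 \<longrightarrow> c1 \<inter> c2 = {}" by blast
  qed
  moreover have "(\<Union>x\<in>X - F. orbit G phi x) = X - F" using sub self by blast
  ultimately have "p dvd card (X - F)" by simp
  moreover have "card X = card F + card (X - F)"
    using card_Un_disjoint[of F "X - F"] \<open>finite X\<close> by (auto simp: F_def Un_absorb1)
  ultimately show ?thesis by (auto simp: F_def)
qed

text \<open>Counting is used twice. Translation by the nonzero \<open>x0\<close> is an action of Z/p
  on \<open>X\<close> without fixed points, so \<open>p\<close> divides \<open>card X\<close>. Hence
  \<open>p\<close> divides the number of fixed points of \<open>G\<close>, and as 0 is one of them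
  there is another.\<close>

lemma p_group_nonzero_fixed_point:
  fixes X :: "('a \<Rightarrow> 'k::field) set"
  assumes G: "group G" "finite (carrier G)" "Coset.order G = p ^ n" and p: "prime p" "CHAR('k) = p"
    and X: "finite X" "0 \<in> X" "\<And>x y. x \<in> X \<Longrightarrow> y \<in> X \<Longrightarrow> x + y \<in> X" "x0 \<in> X" "x0 \<noteq> 0"
    and closed: "\<And>g x. g \<in> carrier G \<Longrightarrow> x \<in> X \<Longrightarrow> f g x \<in> X"
    and one: "\<And>x. x \<in> X \<Longrightarrow> f \<one>\<^bsub>G\<^esub> x = x"
    and mult: "\<And>g h x. g \<in> carrier G \<Longrightarrow> h \<in> carrier G \<Longrightarrow> x \<in> X \<Longrightarrow> f (g \<otimes>\<^bsub>G\<^esub> h) x = f g (f h x)"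
    and zero: "\<And>g. g \<in> carrier G \<Longrightarrow> f g 0 = 0"
  obtains x where "x \<in> X" "x \<noteq> 0" "\<And>g. g \<in> carrier G \<Longrightarrow> f g x = x"
proof -
  define t where "t = (\<lambda>k::int. ((+) x0 ^^ nat k))"
  let ?Z = "integer_mod_group p"
  have p0: "p > 0" "p > 1" using prime_gt_0_nat[OF p(1)] prime_gt_1_nat[OF p(1)] by simp_all
  have carrier_Z: "carrier ?Z = {0..<int p}" using p0 by (simp add: carrier_integer_mod_group)
  have tX: "((+) x0 ^^ m) x \<in> X" if "x \<in> X" for m x
    using that X by (induction m) auto
  have funpow: "((+) x0 ^^ m) x = (\<lambda>a. of_nat m * x0 a + x a)" for m x
    by (induction m) (simp_all add: plus_fun_def algebra_simps)
  have "((+) x0 ^^ p) x = x" for x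
    unfolding funpow using p(2) of_nat_CHAR[where ?'a = 'k] by simp
  then have mod: "((+) x0 ^^ (m mod p)) x = ((+) x0 ^^ m) x" for m x
    by (rule funpow_mod_eq)
  have "card X mod p = card {x \<in> X. \<forall>k\<in>carrier ?Z. t k x = x} mod p"
  proof (rule p_group_card_fixed_points[where n = 1])
    show "Coset.order ?Z = p ^ 1" by (simp add: Coset.order_def carrier_Z)
    fix k l x assume k: "k \<in> carrier ?Z" and l: "l \<in> carrier ?Z"
    have "t (k \<otimes>\<^bsub>?Z\<^esub> l) x = ((+) x0 ^^ (nat (k + l) mod p)) x"
      using k l by (simp add: t_def carrier_Z nat_mod_distrib)
    also have "\<dots> = t k (t l x)"
      unfolding mod using k l by (simp add: t_def carrier_Z nat_add_distrib funpow_add)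
    finally show "t (k \<otimes>\<^bsub>?Z\<^esub> l) x = t k (t l x)" .
  qed (auto simp: p X tX t_def carrier_Z)
  moreover have "{x \<in> X. \<forall>k\<in>carrier ?Z. t k x = x} = {}"
  proof -
    have "1 \<in> carrier ?Z" "t 1 x \<noteq> x" for x
      using p0 X(5) by (simp_all add: carrier_Z t_def)
    then show ?thesis by blast
  qed
  ultimately have "card X mod p = 0" by simp
  then have "card {x \<in> X. \<forall>g\<in>carrier G. f g x = x} mod p = 0"
    using p_group_card_fixed_points[OF G p(1) X(1), of f] closed one mult by simp
  moreover have "{x \<in> X. \<forall>g\<in>carrier G. f g x = x} \<noteq> {0}"
    using calculation p0 by auto
  moreover have "0 \<in> {x \<in> X. \<forall>g\<in>carrier G. f g x = x}" using X zero by auto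
  ultimately show thesis using that by blast
qed

section \<open>Derivations of the group algebra\<close>

text \<open>All functions form the ambient vector space, in which the group algebra is the subspace
  of functions supported on \<open>carrier P\<close>.\<close>

definition fun_scale :: "'k::times \<Rightarrow> ('g \<Rightarrow> 'k) \<Rightarrow> 'g \<Rightarrow> 'k" (infixr "*\<^sub>F" 75) where
  "c *\<^sub>F f = (\<lambda>x. c * f x)"

lemma fun_scale_apply [simp]: "(c *\<^sub>F f) x = c * f x"
  by (simp add: fun_scale_def)

lemma vector_space_fun_scale: "vector_space ((*\<^sub>F) :: 'k::field \<Rightarrow> _)"
  by standard (auto simp: fun_eq_iff algebra_simps)

lemma sum_fun_apply: "sum f I x = (\<Sum>i\<in>I. f i x)"
  by (induction I rule: infinite_finite_induct) auto

locale p_group_algebra = group P for P :: "('g, 'b) monoid_scheme" (structure) +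
  fixes A :: "('k::alg_closed_field, 'g \<Rightarrow> 'k) module" and p n :: nat
  assumes A_def: "A = group_algebra P"
    and finite_P: "finite (carrier P)" and order_P: "Coset.order P = p ^ n"
    and prime_p: "prime p" and char_p: "CHAR('k) = p"
begin

sublocale V: endomorphisms "(*\<^sub>F) :: 'k \<Rightarrow> ('g \<Rightarrow> 'k) \<Rightarrow> 'g \<Rightarrow> 'k"
  by (rule endomorphisms.intro[OF vector_space_fun_scale])

section \<open>The multiplication of the group algebra on coefficient functions\<close>

abbreviation star (infixl "\<star>" 70) where "x \<star> y \<equiv> mult A x y"

definition delta :: "'g \<Rightarrow> 'g \<Rightarrow> 'k" where
  "delta g = (\<lambda>h. if h = g then 1 else 0)"

text \<open>The projection of the ambient space onto the group algebra. Multiplication does not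
  distinguish \<open>x\<close> from \<open>res x\<close>, and total derivations will be required not
  to either, so that they are determined by their values on the group algebra.\<close>

definition res :: "('g \<Rightarrow> 'k) \<Rightarrow> 'g \<Rightarrow> 'k" where
  "res x = (\<lambda>g. if g \<in> carrier P then x g else 0)"

lemma p_pos: "p > 0"
  using prime_p by (simp add: prime_gt_0_nat)

lemma carrier_A: "carrier A = {x. \<forall>g. g \<notin> carrier P \<longrightarrow> x g = 0}"
  and zero_A: "\<zero>\<^bsub>A\<^esub> = 0"
  and add_A: "x \<oplus>\<^bsub>A\<^esub> y = x + y"
  and smult_A: "c \<odot>\<^bsub>A\<^esub> x = c *\<^sub>F x"
  by (auto simp: A_def group_algebra_def delta_def fun_eq_iff)

lemma star_apply:
  "(x \<star> y) g = (if g \<in> carrier P then \<Sum>u\<in>carrier P. x u * y (inv u \<otimes> g) else 0)"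
  by (simp add: A_def group_algebra_def)

lemma minus_A: assumes "x \<in> carrier A" "y \<in> carrier A" shows "x \<ominus>\<^bsub>A\<^esub> y = x - y"
proof -
  have "\<ominus>\<^bsub>A\<^esub> y = - y"
    unfolding a_inv_def m_inv_def using assms(2)
    by (intro the_equality) (auto simp: add_A zero_A carrier_A minus_unique)
  then show ?thesis by (simp add: a_minus_def add_A)
qed

lemma subspace_A: "V.subspace (carrier A)"
  by (auto simp: V.subspace_def carrier_A)

lemma delta_in_A: "g \<in> carrier P \<Longrightarrow> delta g \<in> carrier A"
  by (auto simp: delta_def carrier_A)

lemma star_in_A [simp]: "x \<star> y \<in> carrier A"
  by (simp add: star_apply carrier_A)

lemma star_add_left: "(x + y) \<star> z = x \<star> z + y \<star> z"
  and star_add_right: "z \<star> (x + y) = z \<star> x + z \<star> y"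
  and star_scale_left: "(c *\<^sub>F x) \<star> y = c *\<^sub>F (x \<star> y)"
  and star_scale_right: "x \<star> (c *\<^sub>F y) = c *\<^sub>F (x \<star> y)"
  by (auto simp: fun_eq_iff star_apply algebra_simps sum.distrib sum_distrib_left)

lemma star_diff_left: "(x - y) \<star> z = x \<star> z - y \<star> z"
  and star_diff_right: "z \<star> (x - y) = z \<star> x - z \<star> y"
  by (auto simp: fun_eq_iff star_apply algebra_simps sum_subtractf)

lemma star_zero [simp]: "0 \<star> x = 0" "x \<star> 0 = 0"
  by (auto simp: fun_eq_iff star_apply)

lemma inv_cancel:
  assumes "v \<in> carrier P" "g \<in> carrier P"
  shows "v \<otimes> (inv v \<otimes> g) = g" "inv v \<otimes> (v \<otimes> g) = g"
  using assms by (simp_all flip: m_assoc)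

lemma star_assoc: "x \<star> y \<star> z = x \<star> (y \<star> z)"
proof
  fix g
  show "(x \<star> y \<star> z) g = (x \<star> (y \<star> z)) g"
  proof (cases "g \<in> carrier P")
    case g: True
    have "(x \<star> y \<star> z) g
        = (\<Sum>u\<in>carrier P. \<Sum>v\<in>carrier P. x v * y (inv v \<otimes> u) * z (inv u \<otimes> g))"
      using g by (simp add: star_apply sum_distrib_right)
    also have "\<dots> = (\<Sum>v\<in>carrier P. \<Sum>u\<in>carrier P. x v * y (inv v \<otimes> u) * z (inv u \<otimes> g))"
      by (rule sum.swap)
    also have "\<dots> = (\<Sum>v\<in>carrier P. \<Sum>w\<in>carrier P. x v * y w * z (inv w \<otimes> (inv v \<otimes> g)))"
    proof (rule sum.cong[OF refl])
      fix v assume v: "v \<in> carrier P"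
      show "(\<Sum>u\<in>carrier P. x v * y (inv v \<otimes> u) * z (inv u \<otimes> g))
          = (\<Sum>w\<in>carrier P. x v * y w * z (inv w \<otimes> (inv v \<otimes> g)))"
        using v g m_assoc[of _ v "inv v \<otimes> g"]
        by (intro sum.reindex_bij_witness[of _ "\<lambda>w. v \<otimes> w" "\<lambda>u. inv v \<otimes> u"])
           (auto simp: inv_mult_group m_assoc inv_cancel)
    qed
    also have "\<dots> = (x \<star> (y \<star> z)) g"
      using g by (simp add: star_apply sum_distrib_left mult.assoc)
    finally show ?thesis .
  qed (simp add: star_apply)
qed

lemma res_in_A [simp]: "res x \<in> carrier A"
  by (auto simp: res_def carrier_A)

lemma res_id [simp]: "x \<in> carrier A \<Longrightarrow> res x = x"
  by (auto simp: res_def carrier_A)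

lemma star_res [simp]: "res x \<star> y = x \<star> y" "x \<star> res y = x \<star> y"
  by (auto simp: fun_eq_iff star_apply res_def intro!: sum.cong)

lemma delta_star: "g \<in> carrier P \<Longrightarrow> delta g \<star> x = (\<lambda>h. if h \<in> carrier P then x (inv g \<otimes> h) else 0)"
  using finite_P by (auto simp: fun_eq_iff star_apply delta_def if_distrib[of "\<lambda>a. a * _"] cong: if_cong)

lemma star_delta:
  assumes g: "g \<in> carrier P"
  shows "x \<star> delta g = (\<lambda>h. if h \<in> carrier P then x (h \<otimes> inv g) else 0)"
proof
  fix h
  have "inv u \<otimes> h = g \<longleftrightarrow> u = h \<otimes> inv g" if "u \<in> carrier P" "h \<in> carrier P" for u
    using that g by (metis inv_closed inv_solve_left' inv_solve_right m_closed)
  then have "(\<Sum>u\<in>carrier P. x u * delta g (inv u \<otimes> h))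
      = (\<Sum>u\<in>carrier P. if u = h \<otimes> inv g then x u else 0)" if "h \<in> carrier P"
    using that by (intro sum.cong) (auto simp: delta_def)
  then show "(x \<star> delta g) h = (if h \<in> carrier P then x (h \<otimes> inv g) else 0)"
    using g finite_P by (simp add: star_apply)
qed

lemma delta_one_star [simp]: "delta \<one> \<star> x = res x"
  and star_delta_one [simp]: "x \<star> delta \<one> = res x"
  by (auto simp: fun_eq_iff delta_star star_delta res_def)

lemma delta_delta:
  assumes "g \<in> carrier P" "h \<in> carrier P"
  shows "delta g \<star> delta h = delta (g \<otimes> h)"
  using assms by (auto simp: fun_eq_iff delta_star) (auto simp: delta_def inv_solve_left' inv_cancel)

lemma A_expansion:
  assumes "x \<in> carrier A"
  shows "x = (\<Sum>g\<in>carrier P. x g *\<^sub>F delta g)"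
proof
  fix h
  have "(\<Sum>g\<in>carrier P. x g *\<^sub>F delta g) h = (\<Sum>g\<in>carrier P. if g = h then x h else 0)"
    unfolding sum_fun_apply by (intro sum.cong) (auto simp: delta_def)
  then show "x h = (\<Sum>g\<in>carrier P. x g *\<^sub>F delta g) h"
    using assms finite_P by (simp add: carrier_A)
qed

lemma A_subset_span_delta: "carrier A \<subseteq> V.span (delta ` carrier P)"
proof
  fix x assume "x \<in> carrier A"
  then show "x \<in> V.span (delta ` carrier P)"
    by (subst A_expansion) (auto intro!: V.span_sum V.span_scale intro: V.span_base)
qed

text \<open>Derivations of \<open>A\<close> as total maps on functions: they ignore the values outside \<open>P\<close>.\<close>

definition TD :: "(('g \<Rightarrow> 'k) \<Rightarrow> 'g \<Rightarrow> 'k) set" where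
  "TD = {F. V.endo F \<and> (\<forall>x y. F (x \<star> y) = F x \<star> y + x \<star> F y)
          \<and> (\<forall>x. F (res x) = F x) \<and> (\<forall>x. F x \<in> carrier A)}"

definition ad :: "('g \<Rightarrow> 'k) \<Rightarrow> ('g \<Rightarrow> 'k) \<Rightarrow> 'g \<Rightarrow> 'k" where
  "ad a = (\<lambda>x. a \<star> x - x \<star> a)"

definition commutator :: "(('g \<Rightarrow> 'k) \<Rightarrow> 'g \<Rightarrow> 'k) \<Rightarrow> (('g \<Rightarrow> 'k) \<Rightarrow> 'g \<Rightarrow> 'k) \<Rightarrow> ('g \<Rightarrow> 'k) \<Rightarrow> 'g \<Rightarrow> 'k" where
  "commutator F G = (\<lambda>x. F (G x) - G (F x))"

lemma
  assumes "F \<in> TD"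
  shows TD_endo: "V.endo F" and TD_star: "F (x \<star> y) = F x \<star> y + x \<star> F y"
    and TD_res: "F (res x) = F x" and TD_in_A: "F x \<in> carrier A"
  using assms by (auto simp: TD_def)

lemmas A_closed = subspace_A[THEN V.subspace_add] subspace_A[THEN V.subspace_diff]
  subspace_A[THEN V.subspace_scale] subspace_A[THEN V.subspace_0]

lemma TD_zero: "(\<lambda>x. 0) \<in> TD"
  by (auto simp: TD_def V.endo_iff carrier_A)

lemma TD_add: "F \<in> TD \<Longrightarrow> G \<in> TD \<Longrightarrow> (\<lambda>x. F x + G x) \<in> TD"
  by (auto simp: TD_def V.endo_iff star_add_left star_add_right algebra_simps V.scale_right_distrib intro!: A_closed)

lemma TD_scale: "F \<in> TD \<Longrightarrow> (\<lambda>x. c *\<^sub>F F x) \<in> TD"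
  by (auto simp: TD_def V.endo_iff star_scale_left star_scale_right V.scale_right_distrib mult.commute intro!: A_closed)

lemma TD_diff: "F \<in> TD \<Longrightarrow> G \<in> TD \<Longrightarrow> (\<lambda>x. F x - G x) \<in> TD"
  by (auto simp: TD_def V.endo_iff star_diff_left star_diff_right algebra_simps V.scale_right_diff_distrib intro!: A_closed)

lemma TD_sum: "finite I \<Longrightarrow> (\<And>i. i \<in> I \<Longrightarrow> F i \<in> TD) \<Longrightarrow> (\<lambda>x. \<Sum>i\<in>I. F i x) \<in> TD"
  by (induction I rule: finite_induct) (auto simp: TD_zero TD_add)

lemma TD_commutator: "F \<in> TD \<Longrightarrow> G \<in> TD \<Longrightarrow> commutator F G \<in> TD"
  by (auto simp: TD_def V.endo_iff commutator_def star_diff_left star_diff_right algebra_simps V.scale_right_diff_distrib intro!: A_closed)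

lemma TD_power_p:
  assumes F: "F \<in> TD"
  shows "F ^^ p \<in> TD"
proof -
  have "(F ^^ p) (x \<star> y) = (F ^^ p) x \<star> y + x \<star> (F ^^ p) y" for x y
    by (rule V.Leibniz_CHAR[OF TD_endo[OF F] _ _ _ _ _ prime_p char_p, where X = UNIV and Y = UNIV and B = "(\<star>)" and V = F and W = F])
       (auto simp: TD_star[OF F])
  moreover have "(F ^^ p) (res x) = (F ^^ p) x" "(F ^^ p) x \<in> carrier A" for x
  proof -
    \<comment> \<open>Positivity of \<open>p\<close> matters: \<open>F ^^ 0\<close> is the identity,
      which neither takes values in the group algebra nor ignores values outside P.\<close>
    obtain m where m: "p = Suc m" using p_pos by (cases p) auto
    show "(F ^^ p) (res x) = (F ^^ p) x" unfolding m funpow_Suc_right using TD_res[OF F] by simp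
    show "(F ^^ p) x \<in> carrier A" unfolding m using TD_in_A[OF F] by simp
  qed
  ultimately show ?thesis using V.endo_funpow[OF TD_endo[OF F]] by (simp add: TD_def)
qed

lemma TD_power_p_power: "F \<in> TD \<Longrightarrow> F ^^ (p ^ i) \<in> TD"
proof (induction i)
  case (Suc i)
  have "(F ^^ (p ^ i)) ^^ p = F ^^ (p ^ Suc i)" by (simp add: funpow_mult mult.commute)
  then show ?case using TD_power_p[OF Suc.IH[OF Suc.prems]] by simp
qed simp

lemma TD_delta_one: assumes F: "F \<in> TD" shows "F (delta \<one>) = 0"
proof -
  have "F (delta \<one>) = F (delta \<one> \<star> delta \<one>)" using TD_res[OF F] by simp
  also have "\<dots> = F (delta \<one>) + F (delta \<one>)"
    unfolding TD_star[OF F] using TD_in_A[OF F] by simp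
  finally show ?thesis by simp
qed

lemma ad_TD: "ad a \<in> TD"
  by (auto simp: TD_def ad_def V.endo_iff star_add_left star_add_right star_scale_left star_scale_right
    star_diff_left star_diff_right star_assoc algebra_simps V.scale_right_diff_distrib intro!: A_closed)

lemma ad_res: "ad (res a) = ad a"
  by (simp add: ad_def)

lemma ad_add: "ad a x + ad b x = ad (a + b) x"
  and ad_diff: "ad a x - ad b x = ad (a - b) x"
  and ad_scale: "c *\<^sub>F ad a x = ad (c *\<^sub>F a) x"
  by (auto simp: ad_def star_add_left star_add_right star_diff_left star_diff_right
    star_scale_left star_scale_right V.scale_right_diff_distrib)

lemma commutator_ad: "F \<in> TD \<Longrightarrow> commutator F (ad a) = ad (F a)"
  by (auto simp: fun_eq_iff commutator_def ad_def TD_star V.endo_diff[OF TD_endo])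

text \<open>Writing \<open>D + ad a\<close> as \<open>(D + L) - R\<close> with the left and right multiplications by \<open>a\<close>,
  \<open>D + L\<close> and \<open>D - R\<close> obey twisted Leibniz rules, to which \<open>V.Leibniz_CHAR\<close> applies.\<close>

lemma power_p_add_ad:
  assumes F: "F \<in> TD"
  shows "\<exists>b. ((\<lambda>x. F x + ad a x) ^^ p) = (\<lambda>x. (F ^^ p) x + ad b x)"
proof -
  define E where "E = (\<lambda>x. F x + a \<star> x)"
  define G where "G = (\<lambda>x. F x - x \<star> a)"
  define H where "H = (\<lambda>x. F x + ad a x)"
  have H_TD: "H \<in> TD" using TD_add[OF F ad_TD] by (simp add: H_def)
  have endo: "V.endo E" "V.endo G" "V.endo F" "V.endo H"
    using TD_endo[OF F] TD_endo[OF H_TD]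
    by (auto simp: E_def G_def V.endo_iff star_add_left star_add_right star_scale_left star_scale_right
        V.scale_right_distrib V.scale_right_diff_distrib algebra_simps)
  have "(E ^^ p) (x \<star> y) = (E ^^ p) x \<star> y + x \<star> (F ^^ p) y" for x y
    by (rule V.Leibniz_CHAR[OF endo(1) _ _ _ _ _ prime_p char_p, where X = UNIV and Y = UNIV and B = "(\<star>)" and V = E and W = F])
       (auto simp: TD_star[OF F] E_def star_add_left star_assoc add_ac)
  then have E: "(E ^^ p) (res x) = (E ^^ p) (delta \<one>) \<star> x + res ((F ^^ p) x)" for x
    using delta_one_star by metis
  have "(G ^^ p) (x \<star> y) = (F ^^ p) x \<star> y + x \<star> (G ^^ p) y" for x y
    by (rule V.Leibniz_CHAR[OF endo(2) _ _ _ _ _ prime_p char_p, where X = UNIV and Y = UNIV and B = "(\<star>)" and V = F and W = G])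
       (auto simp: TD_star[OF F] G_def star_diff_right star_assoc algebra_simps)
  have H: "(H ^^ p) (x \<star> y) = (E ^^ p) x \<star> y + x \<star> (G ^^ p) y" for x y
    by (rule V.Leibniz_CHAR[OF endo(4) _ _ _ _ _ prime_p char_p, where X = UNIV and Y = UNIV and B = "(\<star>)" and V = E and W = G])
       (auto simp: TD_star[OF F] G_def E_def H_def ad_def star_diff_right star_diff_left star_add_left star_assoc algebra_simps)
  define b where "b = (E ^^ p) (delta \<one>)"
  define c where "c = (G ^^ p) (delta \<one>)"
  \<comment> \<open>The power of \<open>H\<close> is the power of \<open>F\<close> plus left
    multiplication by \<open>b\<close> plus right multiplication by \<open>c\<close>. A derivation
    kills 1, which forces \<open>c\<close> to be - \<open>b\<close> on P, and the two extra terms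
    combine to \<open>ad b\<close>.\<close>
  have "(H ^^ p) (delta \<one>) = res b + res c"
    using H[of "delta \<one>" "delta \<one>"] delta_in_A[of \<one>] by (simp add: b_def c_def)
  then have "res c = - res b"
    using TD_delta_one[OF TD_power_p[OF H_TD]] by (simp add: add_eq_0_iff)
  then have c: "x \<star> c = - (x \<star> b)" for x
    using star_res(2)[of x c] star_res(2)[of x "- b"] star_diff_right[of x 0 b]
    by (metis diff_0 star_diff_right star_res(2) star_zero(2))
  have "(H ^^ p) x = (F ^^ p) x + ad b x" for x
  proof -
    have Fp: "(F ^^ p) x \<in> carrier A" by (rule TD_in_A[OF TD_power_p[OF F]])
    have "(E ^^ p) (res x) \<in> carrier A"
      using E[of x] by (simp add: A_closed)
    have "(H ^^ p) x = (H ^^ p) (res x \<star> delta \<one>)"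
      using TD_res[OF TD_power_p[OF H_TD]] by simp
    also have "\<dots> = (E ^^ p) (res x) + x \<star> c"
      unfolding H using \<open>(E ^^ p) (res x) \<in> carrier A\<close> by (simp add: c_def)
    also have "\<dots> = (F ^^ p) x + ad b x"
      using E[of x] Fp by (simp add: b_def c ad_def)
    finally show ?thesis .
  qed
  then show ?thesis unfolding H_def by (intro exI[of _ b]) auto
qed

text \<open>E (F x) = [E, F] x + F (E x) is a Leibniz rule for the evaluation of \<open>F\<close> at
  \<open>x\<close>, so \<open>Leibniz_CHAR\<close> applies with the commutator acting on the first
  argument.\<close>

lemma commutator_power_p:
  assumes E: "V.endo E" and F: "V.endo F"
  shows "(commutator E ^^ p) F = commutator (E ^^ p) F"
proof
  fix x
  have "(E ^^ p) (F x) = (commutator E ^^ p) F x + F ((E ^^ p) x)"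
    by (rule V.Leibniz_CHAR[OF E _ _ _ _ _ prime_p char_p, where X = UNIV and Y = UNIV and B = "\<lambda>F x. F x" and V = "commutator E" and W = E])
       (auto simp: commutator_def)
  then show "(commutator E ^^ p) F x = commutator (E ^^ p) F x"
    by (simp add: commutator_def)
qed

lemma endo_commutator: "V.endo E \<Longrightarrow> V.endo F \<Longrightarrow> V.endo (commutator E F)"
  by (auto simp: V.endo_iff commutator_def algebra_simps V.scale_right_diff_distrib)

lemma commutator_power_p_power:
  assumes E: "V.endo E" and F: "V.endo F"
  shows "(commutator E ^^ (p ^ i)) F = commutator (E ^^ (p ^ i)) F"
  using F
proof (induction i arbitrary: F)
  case (Suc i)
  define C where "C = commutator E ^^ (p ^ i)"
  have C: "C F = commutator (E ^^ (p ^ i)) F" if "V.endo F" for F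
    using Suc.IH[OF that] by (simp add: C_def)
  \<comment> \<open>\<open>C\<close> is known to agree with the commutator only on linear maps, so
    linearity of the iterates is carried through the induction.\<close>
  have "V.endo ((C ^^ j) F) \<and> (C ^^ j) F = (commutator (E ^^ (p ^ i)) ^^ j) F" for j
    using Suc.prems
    by (induction j) (auto simp: C intro!: endo_commutator V.endo_funpow E)
  then have "(C ^^ p) F = commutator ((E ^^ (p ^ i)) ^^ p) F"
    using commutator_power_p[OF V.endo_funpow[OF E] Suc.prems] by simp
  then show ?case by (simp add: C_def funpow_mult mult.commute)
qed simp

end

text \<open>With these rules the simplifier expands vectors such as \<open>c *\<^sub>F x\<close> pointwise even when they are not applied.\<close>

declare fun_scale_apply [simp del] plus_fun_apply [simp del] zero_fun_apply [simp del]
  minus_apply [simp del] uminus_apply [simp del]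

context p_group_algebra
begin

section \<open>The restricted Lie algebra \<open>HH\<^sup>1\<close>\<close>

abbreviation rst :: "(('g \<Rightarrow> 'k) \<Rightarrow> 'g \<Rightarrow> 'k) \<Rightarrow> ('g \<Rightarrow> 'k) \<Rightarrow> 'g \<Rightarrow> 'k" where
  "rst F \<equiv> restrict F (carrier A)"

abbreviation H :: "('k, (('g \<Rightarrow> 'k) \<Rightarrow> 'g \<Rightarrow> 'k) set) restricted_lie" where
  "H \<equiv> HH1 A"

text \<open>The coset of the total map \<open>F\<close> in HH^1, consisting of the restrictions to
  the group algebra of all \<open>F + ad a\<close>. The operations of \<open>H\<close> are computed
  on total maps through it.\<close>

definition cls :: "(('g \<Rightarrow> 'k) \<Rightarrow> 'g \<Rightarrow> 'k) \<Rightarrow> (('g \<Rightarrow> 'k) \<Rightarrow> 'g \<Rightarrow> 'k) set" where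
  "cls F = range (\<lambda>a. rst (\<lambda>x. F x + ad a x))"

lemma rst_inject: "F \<in> TD \<Longrightarrow> G \<in> TD \<Longrightarrow> rst F = rst G \<Longrightarrow> F = G"
proof
  fix x assume F: "F \<in> TD" and G: "G \<in> TD" and eq: "rst F = rst G"
  have "F (res x) = G (res x)"
    using fun_cong[OF eq, of "res x"] by simp
  then show "F x = G x" using TD_res F G by metis
qed

lemma derivations_A: "derivations A = rst ` TD"
proof
  show "derivations A \<subseteq> rst ` TD"
  proof
    fix D assume D: "D \<in> derivations A"
    define F where "F = (\<lambda>x. D (res x))"
    have res: "res (x + y) = res x + res y" "res (c *\<^sub>F x) = c *\<^sub>F res x" for x y c
      by (auto simp: res_def fun_eq_iff plus_fun_apply fun_scale_apply)
    have DE: "D \<in> carrier A \<rightarrow>\<^sub>E carrier A"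
      using D unfolding derivations_def by blast
    have DA: "D x \<in> carrier A" if "x \<in> carrier A" for x
      using DE that by blast
    have D_add: "D (x + y) = D x + D y" and D_star: "D (x \<star> y) = D x \<star> y + x \<star> D y"
      if "x \<in> carrier A" "y \<in> carrier A" for x y
      using D that by (auto simp: derivations_def add_A)
    have D_scale: "D (c *\<^sub>F x) = c *\<^sub>F D x" if "x \<in> carrier A" for c x
      using D that by (auto simp: derivations_def smult_A)
    have D_star': "D (x \<star> y) = D (res x) \<star> y + x \<star> D (res y)" for x y
      using D_star[of "res x" "res y"] by simp
    have "V.endo F"
      unfolding V.endo_iff F_def res using D_add D_scale by simp
    moreover have "F (x \<star> y) = F x \<star> y + x \<star> F y" for x y
      unfolding F_def using D_star' by simp
    ultimately have "F \<in> TD"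
      unfolding TD_def using DA by (simp add: F_def)
    moreover have "D = rst F"
    proof
      fix x show "D x = rst F x"
        by (cases "x \<in> carrier A") (simp_all add: F_def PiE_arb[OF DE])
    qed
    ultimately show "D \<in> rst ` TD" by blast
  qed
  show "rst ` TD \<subseteq> derivations A"
  proof
    fix D assume "D \<in> rst ` TD"
    then obtain F where F: "F \<in> TD" "D = rst F" by blast
    then show "D \<in> derivations A"
      using TD_in_A[OF F(1)]
      by (auto simp: derivations_def add_A smult_A A_closed TD_star
          V.endo_add[OF TD_endo] V.endo_scale[OF TD_endo])
  qed
qed

lemma inner_derivations_A: "inner_derivations A = rst ` range ad"
proof -
  have "inner_derivations A = (\<lambda>a. rst (ad a)) ` carrier A"
    by (auto simp: inner_derivations_def ad_def minus_A intro!: image_cong restrict_ext)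
  also have "\<dots> = rst ` range ad"
  proof -
    have "rst (ad a) \<in> (\<lambda>a. rst (ad a)) ` carrier A" for a
      by (rule image_eqI[of _ _ "res a"]) (simp_all add: ad_res)
    then show ?thesis by auto
  qed
  finally show ?thesis .
qed

lemma Der_A:
  assumes F: "F \<in> TD" and G: "G \<in> TD"
  shows "rst F \<oplus>\<^bsub>Der A\<^esub> rst G = rst (\<lambda>x. F x + G x)"
    and "rst F \<otimes>\<^bsub>Der A\<^esub> rst G = rst (commutator F G)"
    and "c \<odot>\<^bsub>Der A\<^esub> rst F = rst (\<lambda>x. c *\<^sub>F F x)"
    and "p_power (Der A) (rst F) = rst (F ^^ p)"
proof -
  show "rst F \<oplus>\<^bsub>Der A\<^esub> rst G = rst (\<lambda>x. F x + G x)"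
    by (auto simp: Der_def add_A fun_eq_iff)
  show "rst F \<otimes>\<^bsub>Der A\<^esub> rst G = rst (commutator F G)"
    using TD_in_A[OF F] TD_in_A[OF G]
    by (auto simp: Der_def commutator_def minus_A intro!: restrict_ext)
  show "c \<odot>\<^bsub>Der A\<^esub> rst F = rst (\<lambda>x. c *\<^sub>F F x)"
    by (auto simp: Der_def smult_A fun_eq_iff)
  have "(rst F ^^ m) x = (F ^^ m) x \<and> (F ^^ m) x \<in> carrier A" if "x \<in> carrier A" for m x
    using that TD_in_A[OF F] by (induction m) auto
  then show "p_power (Der A) (rst F) = rst (F ^^ p)"
    by (auto simp: Der_def char_p intro!: restrict_ext)
qed

lemma carrier_Der: "carrier (Der A) = rst ` TD"
  by (simp add: Der_def derivations_A)

lemma cls_altdef: "F \<in> TD \<Longrightarrow> inner_derivations A +>\<^bsub>Der A\<^esub> rst F = cls F"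
  by (auto simp: a_r_coset_def' inner_derivations_A Der_A(1) ad_TD cls_def add.commute)

lemma mem_clsI: "rst (\<lambda>x. F x + ad a x) \<in> cls F"
  by (auto simp: cls_def)

lemma mem_cls_self: "rst F \<in> cls F"
  using mem_clsI[of F 0] by (simp add: ad_def)

lemma cls_cong:
  assumes "\<And>x. F x = G x + ad a x"
  shows "cls F = cls G"
proof
  have "rst (\<lambda>x. F x + ad b x) = rst (\<lambda>x. G x + ad (a + b) x)" for b
    by (simp add: assms add.assoc ad_add)
  then show "cls F \<subseteq> cls G" unfolding cls_def by blast
  have "rst (\<lambda>x. G x + ad b x) = rst (\<lambda>x. F x + ad (b - a) x)" for b
    by (simp add: assms add.assoc ad_add)
  then show "cls G \<subseteq> cls F" unfolding cls_def by blast
qed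

lemma cls_eqD:
  assumes F: "F \<in> TD" and G: "G \<in> TD" and eq: "cls F = cls G"
  obtains a where "\<And>x. F x = G x + ad a x"
proof -
  have "rst F \<in> cls G" using mem_cls_self[of F] eq by simp
  then obtain a where "rst F = rst (\<lambda>x. G x + ad a x)" by (auto simp: cls_def)
  then have "F = (\<lambda>x. G x + ad a x)"
    by (rule rst_inject[OF F TD_add[OF G ad_TD]])
  then show thesis using that by metis
qed

lemma carrier_H: "carrier H = cls ` TD"
proof -
  have "carrier H = (\<Union>F\<in>TD. {inner_derivations A +>\<^bsub>Der A\<^esub> rst F})"
    by (simp add: HH1_def restricted_lie_quotient_def A_RCOSETS_def' carrier_Der)
  also have "\<dots> = (\<Union>F\<in>TD. {cls F})"
    by (rule SUP_cong) (simp_all add: cls_altdef)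
  finally show ?thesis by blast
qed

lemma zero_H: "\<zero>\<^bsub>H\<^esub> = cls (\<lambda>x. 0)"
  by (simp add: HH1_def restricted_lie_quotient_def inner_derivations_A cls_def image_image)

lemma add_H:
  assumes F: "F \<in> TD" and G: "G \<in> TD"
  shows "cls F \<oplus>\<^bsub>H\<^esub> cls G = cls (\<lambda>x. F x + G x)"
proof -
  have *: "rst (\<lambda>x. F x + ad a x) \<oplus>\<^bsub>Der A\<^esub> rst (\<lambda>x. G x + ad b x)
      = rst (\<lambda>x. F x + G x + ad (a + b) x)" for a b
    by (subst Der_A(1)) (auto intro!: TD_add F G ad_TD restrict_ext simp: add_ac simp flip: ad_add)
  have "cls F \<oplus>\<^bsub>H\<^esub> cls G
      = (\<Union>a. \<Union>b. {rst (\<lambda>x. F x + ad a x) \<oplus>\<^bsub>Der A\<^esub> rst (\<lambda>x. G x + ad b x)})"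
    by (auto simp: HH1_def restricted_lie_quotient_def set_add_def' cls_def)
  also have "\<dots> = cls (\<lambda>x. F x + G x)"
  proof -
    have "rst (\<lambda>x. F x + G x + ad c x) \<in> (\<Union>a. \<Union>b. {rst (\<lambda>x. F x + G x + ad (a + b) x)})" for c
      by (rule UN_I[of 0], simp, rule UN_I[of c]) simp_all
    then show ?thesis unfolding * cls_def by blast
  qed
  finally show ?thesis .
qed

lemma smult_H:
  assumes F: "F \<in> TD"
  shows "c \<odot>\<^bsub>H\<^esub> cls F = cls (\<lambda>x. c *\<^sub>F F x)"
proof -
  have "inner_derivations A +>\<^bsub>Der A\<^esub> (c \<odot>\<^bsub>Der A\<^esub> rst (\<lambda>x. F x + ad a x)) = cls (\<lambda>x. c *\<^sub>F F x)" for a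
  proof -
    have "inner_derivations A +>\<^bsub>Der A\<^esub> (c \<odot>\<^bsub>Der A\<^esub> rst (\<lambda>x. F x + ad a x))
        = cls (\<lambda>x. c *\<^sub>F (F x + ad a x))"
      using TD_add[OF F ad_TD] by (subst Der_A(3)) (auto intro!: cls_altdef TD_scale)
    also have "\<dots> = cls (\<lambda>x. c *\<^sub>F F x)"
      by (rule cls_cong[where a = "c *\<^sub>F a"]) (simp add: V.scale_right_distrib ad_scale)
    finally show ?thesis .
  qed
  then show ?thesis
    by (auto simp: HH1_def restricted_lie_quotient_def cls_def[of F])
qed

text \<open>The operation on a coset is a union over all representatives; by
  \<open>power_p_add_ad\<close> every representative contributes the same coset.\<close>

lemma p_power_H:
  assumes F: "F \<in> TD"
  shows "p_power H (cls F) = cls (F ^^ p)"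
proof -
  have "inner_derivations A +>\<^bsub>Der A\<^esub> p_power (Der A) (rst (\<lambda>x. F x + ad a x)) = cls (F ^^ p)" for a
  proof -
    obtain b where b: "(\<lambda>x. F x + ad a x) ^^ p = (\<lambda>x. (F ^^ p) x + ad b x)"
      using power_p_add_ad[OF F] by blast
    have "inner_derivations A +>\<^bsub>Der A\<^esub> p_power (Der A) (rst (\<lambda>x. F x + ad a x))
        = cls ((\<lambda>x. F x + ad a x) ^^ p)"
      using TD_add[OF F ad_TD] by (subst Der_A(4)) (auto intro!: cls_altdef TD_power_p)
    also have "\<dots> = cls (F ^^ p)"
      unfolding b by (rule cls_cong) simp
    finally show ?thesis .
  qed
  then show ?thesis
    by (auto simp: HH1_def restricted_lie_quotient_def cls_def[of F])
qed

text \<open>Inner derivations form an ideal because [F, ad a] = ad (F a); the correction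
  \<open>F' b - G a\<close> in the proof collects the two resulting terms.\<close>

lemma mult_H:
  assumes F: "F \<in> TD" and G: "G \<in> TD"
  shows "cls F \<otimes>\<^bsub>H\<^esub> cls G = cls (commutator F G)"
proof -
  have "inner_derivations A +>\<^bsub>Der A\<^esub>
      (rst (\<lambda>x. F x + ad a x) \<otimes>\<^bsub>Der A\<^esub> rst (\<lambda>x. G x + ad b x)) = cls (commutator F G)" for a b
  proof -
    define F' where "F' = (\<lambda>x. F x + ad a x)"
    define G' where "G' = (\<lambda>x. G x + ad b x)"
    have TD: "F' \<in> TD" "G' \<in> TD" using TD_add F G ad_TD by (auto simp: F'_def G'_def)
    have "inner_derivations A +>\<^bsub>Der A\<^esub> (rst F' \<otimes>\<^bsub>Der A\<^esub> rst G') = cls (commutator F' G')"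
      using TD by (simp add: Der_A(2) cls_altdef TD_commutator)
    also have "\<dots> = cls (commutator F G)"
    proof (rule cls_cong)
      fix x
      have "commutator F' G' x = commutator F G x + commutator F' (ad b) x - commutator G (ad a) x"
        unfolding commutator_def F'_def G'_def V.endo_add[OF TD_endo[OF F]] V.endo_add[OF TD_endo[OF G]]
          V.endo_add[OF TD_endo[OF ad_TD]]
        by (simp only: algebra_simps)
      then show "commutator F' G' x = commutator F G x + ad (F' b - G a) x"
        using TD G by (simp add: commutator_ad ad_diff[symmetric])
    qed
    finally show ?thesis by (simp add: F'_def G'_def)
  qed
  then show ?thesis
    by (auto simp: HH1_def restricted_lie_quotient_def rcoset_mult_def cls_def[of F] cls_def[of G])
qed

lemma abelian_monoid_H: "abelian_monoid H"
proof (rule abelian_monoidI)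
  fix x y z assume "x \<in> carrier H" "y \<in> carrier H" "z \<in> carrier H"
  then show "x \<oplus>\<^bsub>H\<^esub> y \<in> carrier H" "x \<oplus>\<^bsub>H\<^esub> y \<oplus>\<^bsub>H\<^esub> z = x \<oplus>\<^bsub>H\<^esub> (y \<oplus>\<^bsub>H\<^esub> z)"
    "x \<oplus>\<^bsub>H\<^esub> y = y \<oplus>\<^bsub>H\<^esub> x" "\<zero>\<^bsub>H\<^esub> \<oplus>\<^bsub>H\<^esub> x = x"
    by (auto simp: carrier_H add_H zero_H TD_add TD_zero add_ac)
qed (auto simp: zero_H carrier_H TD_zero)

lemma lin_comb_H:
  assumes "finite S" "\<And>s. s \<in> S \<Longrightarrow> D s \<in> TD" "\<And>s. s \<in> S \<Longrightarrow> cls (D s) = s"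
  shows "lin_comb H c S = cls (\<lambda>x. \<Sum>s\<in>S. c s *\<^sub>F D s x)"
proof -
  interpret abelian_monoid H by (rule abelian_monoid_H)
  have smult: "c s \<odot>\<^bsub>H\<^esub> s = cls (\<lambda>x. c s *\<^sub>F D s x)" if "s \<in> S" for s
    using smult_H[OF assms(2)[OF that]] assms(3)[OF that] by simp
  have "(\<Oplus>\<^bsub>H\<^esub>s\<in>R. c s \<odot>\<^bsub>H\<^esub> s) = cls (\<lambda>x. \<Sum>s\<in>R. c s *\<^sub>F D s x)" if "finite R" "R \<subseteq> S" for R
    using that
  proof (induction R rule: finite_induct)
    case empty
    show ?case by (simp only: finsum_empty zero_H sum.empty)
  next
    case (insert s R)
    have TD: "(\<lambda>x. c s *\<^sub>F D s x) \<in> TD" if "s \<in> S" for s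
      using assms(2) that by (simp add: TD_scale)
    have "(\<Oplus>\<^bsub>H\<^esub>s\<in>insert s R. c s \<odot>\<^bsub>H\<^esub> s) = c s \<odot>\<^bsub>H\<^esub> s \<oplus>\<^bsub>H\<^esub> (\<Oplus>\<^bsub>H\<^esub>s\<in>R. c s \<odot>\<^bsub>H\<^esub> s)"
      using insert.hyps insert.prems smult TD by (intro finsum_insert) (auto simp: carrier_H)
    also have "\<dots> = cls (\<lambda>x. c s *\<^sub>F D s x + (\<Sum>s\<in>R. c s *\<^sub>F D s x))"
    proof -
      have "(\<Oplus>\<^bsub>H\<^esub>s\<in>R. c s \<odot>\<^bsub>H\<^esub> s) = cls (\<lambda>x. \<Sum>s\<in>R. c s *\<^sub>F D s x)" "s \<in> S"
        using insert by blast+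
      moreover have "(\<lambda>x. \<Sum>s\<in>R. c s *\<^sub>F D s x) \<in> TD"
        using insert TD by (intro TD_sum) auto
      ultimately show ?thesis
        using smult TD by (simp only: add_H)
    qed
    finally show ?case unfolding sum.insert[OF insert.hyps] .
  qed
  then show ?thesis using assms(1) by (simp add: lin_comb_def)
qed

section \<open>Lifting tori to commuting diagonalisable derivations\<close>

text \<open>The \<open>p\<close>-power map preserves the Leibniz rule, so each term x^(p^i)
  evaluates to a derivation.\<close>

lemma act_TD:
  assumes F: "F \<in> TD" and h: "h \<in> p_polys p N"
  shows "V.act F h \<in> TD"
  using h
proof (induction rule: p_polys.induct)
  case zero
  have "V.act F 0 = (\<lambda>x. 0)" by (rule ext) simp
  then show ?case by (simp only: TD_zero)
next
  case (step h i c)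
  have "V.act F (h + monom c (p ^ i)) = (\<lambda>x. V.act F h x + c *\<^sub>F (F ^^ (p ^ i)) x)"
    by (rule ext) (simp only: V.act_add V.act_monom)
  then show ?case
    using step.IH TD_scale[OF TD_power_p_power[OF F]] by (simp only: TD_add)
qed

text \<open>An explicit restricted subalgebra that bounds generated ones from above. Brackets vanish
  since polynomials in one \<open>F\<close> commute, and taking \<open>p\<close>-th powers only
  raises the exponents.\<close>

lemma restricted_subalgebra_act:
  assumes F: "F \<in> TD"
  shows "restricted_subalgebra H ((\<lambda>h. cls (V.act F h)) ` p_polys p N)" (is "restricted_subalgebra H ?S")
proof -
  note TD = act_TD[OF F, of _ N]
  have zero: "V.act F 0 = (\<lambda>x. 0)" by (rule ext) simp
  have zero_mem: "\<zero>\<^bsub>H\<^esub> \<in> ?S"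
    unfolding zero_H by (rule image_eqI[of _ _ 0]) (simp_all only: zero p_polys.zero)
  show ?thesis
    unfolding restricted_subalgebra_def
  proof (intro conjI ballI allI)
    show "?S \<subseteq> carrier H" using TD by (auto simp: carrier_H)
    show "\<zero>\<^bsub>H\<^esub> \<in> ?S" by (rule zero_mem)
  next
    fix x y assume "x \<in> ?S" "y \<in> ?S"
    then obtain f g where f: "f \<in> p_polys p N" "x = cls (V.act F f)"
      and g: "g \<in> p_polys p N" "y = cls (V.act F g)" by blast
    have "x \<oplus>\<^bsub>H\<^esub> y = cls (V.act F (f + g))"
      using TD f g by (simp only: add_H V.act_add[abs_def])
    then show "x \<oplus>\<^bsub>H\<^esub> y \<in> ?S" using p_polys_add f g by blast
    have "commutator (V.act F f) (V.act F g) = (\<lambda>x. 0)"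
      by (auto simp: commutator_def V.act_mult[OF TD_endo[OF F], symmetric] mult.commute)
    then have "x \<otimes>\<^bsub>H\<^esub> y = \<zero>\<^bsub>H\<^esub>"
      using TD f g by (simp only: mult_H zero_H)
    then show "x \<otimes>\<^bsub>H\<^esub> y \<in> ?S" using zero_mem by simp
  next
    fix c x assume "x \<in> ?S"
    then obtain f where f: "f \<in> p_polys p N" "x = cls (V.act F f)" by blast
    have "c \<odot>\<^bsub>H\<^esub> x = cls (V.act F (Polynomial.smult c f))"
      using TD f by (simp only: smult_H V.act_smult[abs_def])
    then show "c \<odot>\<^bsub>H\<^esub> x \<in> ?S" using p_polys_smult f by blast
  next
    fix x assume "x \<in> ?S"
    then obtain f where f: "f \<in> p_polys p N" "x = cls (V.act F f)" by blast
    have "p_power H x = cls (V.act F (f ^ p))"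
      using TD f V.act_power[OF TD_endo[OF F], of f p]
      by (simp only: p_power_H) (metis ext)
    then show "p_power H x \<in> ?S"
      using p_polys_antimono[OF p_polys_power[OF f(1) prime_p char_p]] by auto
  qed
qed

text \<open>If \<open>F\<close> is h(F) modulo inner derivations with exponents at least
  \<open>N\<close>, its \<open>p\<close>-power is h^p(F) with exponents at least
  \<open>N + 1\<close>, and semisimplicity puts the class of \<open>F\<close> in the restricted
  subalgebra generated by that power. Starting from h = x, any bound \<open>N\<close> is
  reached.\<close>

lemma semisimple_eq_act:
  assumes F: "F \<in> TD" and ss: "semisimple_elem H (cls F)"
  shows "\<exists>h\<in>p_polys p N. cls F = cls (V.act F h)"
proof (induction N)
  case 0
  have "V.act F (monom 1 (p ^ 0)) = F"
    by (rule ext) (simp add: V.act_monom)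
  then show ?case using p_polys_monom[of 0 0 1 p] by (intro bexI[of _ "monom 1 (p ^ 0)"]) auto
next
  case (Suc N)
  then obtain h where h: "h \<in> p_polys p N" "cls F = cls (V.act F h)" by blast
  have "p_power H (cls F) = cls (V.act F h ^^ p)"
    unfolding h(2) by (rule p_power_H[OF act_TD[OF F h(1)]])
  also have "V.act F h ^^ p = V.act F (h ^ p)"
    using V.act_power[OF TD_endo[OF F], of h p] by (metis ext)
  finally have "p_power H (cls F) \<in> (\<lambda>h. cls (V.act F h)) ` p_polys p (Suc N)"
    using p_polys_power[OF h(1) prime_p char_p] by blast
  then have "restricted_subalgebra_generated H {p_power H (cls F)}
      \<subseteq> (\<lambda>h. cls (V.act F h)) ` p_polys p (Suc N)"
    using restricted_subalgebra_act[OF F, of "Suc N"]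
    unfolding restricted_subalgebra_generated_def by blast
  then show ?case using ss unfolding semisimple_elem_def by blast
qed

text \<open>Since \<open>M\<close> is a set, the annihilating product has simple roots, so this says
  that \<open>E\<close> is diagonalisable on the group algebra. In this form the property passes to
  invariant subspaces at once, and \<open>M\<close> provides the points for interpolation.\<close>

definition diag :: "(('g \<Rightarrow> 'k) \<Rightarrow> 'g \<Rightarrow> 'k) \<Rightarrow> bool" where
  "diag E \<longleftrightarrow> (\<exists>M. finite M \<and> (\<forall>v\<in>carrier A. V.act E (\<Prod>m\<in>M. [:- m, 1:]) v = 0))"

lemma diagI:
  assumes E: "V.endo E" and span: "carrier A \<subseteq> V.span {u \<in> carrier A. \<exists>m. E u = m *\<^sub>F u}"
  shows "diag E"
proof -
  \<comment> \<open>A basis made of eigenvectors is finite, which leaves finitely many eigenvalues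
    for the annihilating product.\<close>
  obtain B where B: "B \<subseteq> {u \<in> carrier A. \<exists>m. E u = m *\<^sub>F u}" "V.independent B"
    "{u \<in> carrier A. \<exists>m. E u = m *\<^sub>F u} \<subseteq> V.span B"
    using V.maximal_independent_subset by blast
  have "B \<subseteq> V.span (delta ` carrier P)" using B(1) A_subset_span_delta by blast
  then have "finite B"
    using V.independent_span_bound[of "delta ` carrier P" B] B(2) finite_P by blast
  have "\<forall>u\<in>B. \<exists>m. E u = m *\<^sub>F u" using B(1) by blast
  then obtain f where f: "\<And>u. u \<in> B \<Longrightarrow> E u = f u *\<^sub>F u" by (auto dest!: bchoice)
  have "carrier A \<subseteq> V.span {u. \<exists>m\<in>f ` B. E u = m *\<^sub>F u}"
  proof -
    have "B \<subseteq> {u. \<exists>m\<in>f ` B. E u = m *\<^sub>F u}" using f by blast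
    moreover have "carrier A \<subseteq> V.span B"
      using span V.span_mono[OF B(3)] by (simp add: V.span_span)
    ultimately show ?thesis using V.span_mono by blast
  qed
  then show ?thesis
    unfolding diag_def using \<open>finite B\<close> V.act_eq_0_if_span_eigenvectors[OF E, of "f ` B"] by blast
qed

lemma diag_invariant_subspace:
  assumes E: "V.endo E" and "diag E" and S: "V.subspace S" "S \<subseteq> carrier A" "\<And>v. v \<in> S \<Longrightarrow> E v \<in> S"
  shows "S \<subseteq> V.span {u \<in> S. \<exists>m. E u = m *\<^sub>F u}"
proof
  fix v assume v: "v \<in> S"
  obtain M where M: "finite M" "\<And>v. v \<in> carrier A \<Longrightarrow> V.act E (\<Prod>m\<in>M. [:- m, 1:]) v = 0"
    using \<open>diag E\<close> unfolding diag_def by blast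
  have "v \<in> V.span {u \<in> S. \<exists>m\<in>M. E u = m *\<^sub>F u}"
    using V.span_eigenvectors_if_act_eq_0[OF E S(1,3) M(1) v] M(2) v S(2) by blast
  moreover have "{u \<in> S. \<exists>m\<in>M. E u = m *\<^sub>F u} \<subseteq> {u \<in> S. \<exists>m. E u = m *\<^sub>F u}" by blast
  ultimately show "v \<in> V.span {u \<in> S. \<exists>m. E u = m *\<^sub>F u}" using V.span_mono by blast
qed

text \<open>For each \<open>v\<close> the q + 1 vectors \<open>(F ^^ i) v\<close> lie in a space of
  dimension q = |P|, so a nonzero polynomial of degree at most q kills \<open>v\<close>. It divides
  a product of factors (x - l)^q = x^q - l^q, and the l^q are distinct for distinct l; hence
  \<open>F ^^ q\<close> satisfies an equation with simple roots on \<open>v\<close>.\<close>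

lemma power_order_diag:
  assumes F: "F \<in> TD"
  shows "carrier A \<subseteq> V.span {u \<in> carrier A. \<exists>m. (F ^^ (p ^ n)) u = m *\<^sub>F u}"
proof
  fix v assume v: "v \<in> carrier A"
  define q where "q = p ^ n"
  have q: "card (carrier P) = q" using order_P by (simp add: q_def Coset.order_def)
  have endo: "V.endo F" "V.endo (F ^^ q)"
    using TD_endo[OF F] V.endo_funpow by auto
  have FA: "(F ^^ i) v \<in> carrier A" for i
    using v TD_in_A[OF F] by (cases i) auto
  obtain c where c: "\<exists>i\<in>{..q}. c i \<noteq> 0" "\<forall>g\<in>carrier P. (\<Sum>i\<in>{..q}. c i * (F ^^ i) v g) = 0"
    using homogeneous_system[of "carrier P" "{..q}" "\<lambda>i g. (F ^^ i) v g"] finite_P q by auto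
  define f where "f = (\<Sum>i\<le>q. monom (c i) i)"
  have coeff: "coeff f i = (if i \<le> q then c i else 0)" for i
    by (simp add: f_def coeff_sum)
  have "f \<noteq> 0" using c(1) coeff by (metis atMost_iff coeff_0)
  have deg: "degree f \<le> q" by (rule degree_le) (simp add: coeff)
  have "V.act F f v = 0"
  proof
    fix g
    have "V.act F f v g = (\<Sum>i\<le>q. c i * (F ^^ i) v g)"
      unfolding V.act_upto[OF deg] sum_fun_apply by (intro sum.cong) (auto simp: coeff fun_scale_apply)
    also have "\<dots> = 0"
      using c(2) FA by (cases "g \<in> carrier P") (auto simp: carrier_A)
    finally show "V.act F f v g = 0 g" by (simp add: zero_fun_apply)
  qed
  obtain R where R: "finite R" "f dvd (\<Prod>l\<in>R. [:- l, 1:] ^ q)"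
    using dvd_prod_linear_factors[OF \<open>f \<noteq> 0\<close> deg] by blast
  then obtain f' where f': "(\<Prod>l\<in>R. [:- l, 1:] ^ q) = f' * f" by (metis dvdE mult.commute)
  have "inj_on (\<lambda>l. l ^ q) R"
    using inj_power_char[OF prime_p char_p] by (auto simp: inj_on_def q_def)
  then have "pcompose (\<Prod>m\<in>(\<lambda>l. l ^ q) ` R. [:- m, 1:]) (monom 1 q) = (\<Prod>l\<in>R. [:- l, 1:] ^ q)"
    unfolding pcompose_prod q_def
    by (simp add: prod.reindex linear_factor_power_char[OF prime_p char_p])
  then have "V.act (F ^^ q) (\<Prod>m\<in>(\<lambda>l. l ^ q) ` R. [:- m, 1:]) v = 0"
    unfolding V.act_funpow[OF endo(1)] f'
    using \<open>V.act F f v = 0\<close> by (simp add: V.act_mult[OF endo(1)] V.endo_zero[OF V.endo_act[OF endo(1)]])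
  then have "v \<in> V.span {u \<in> carrier A. \<exists>m\<in>(\<lambda>l. l ^ q) ` R. (F ^^ q) u = m *\<^sub>F u}"
    using V.span_eigenvectors_if_act_eq_0[OF endo(2) subspace_A _ _ v, of "(\<lambda>l. l ^ q) ` R"]
      TD_in_A[OF TD_power_p_power[OF F]] R(1) by (simp add: q_def)
  moreover have "{u \<in> carrier A. \<exists>m\<in>(\<lambda>l. l ^ q) ` R. (F ^^ q) u = m *\<^sub>F u}
      \<subseteq> {u \<in> carrier A. \<exists>m. (F ^^ (p ^ n)) u = m *\<^sub>F u}" by (auto simp: q_def)
  ultimately show "v \<in> V.span {u \<in> carrier A. \<exists>m. (F ^^ (p ^ n)) u = m *\<^sub>F u}"
    using V.span_mono by blast
qed

lemma diag_act:
  assumes F: "F \<in> TD" and h: "h \<in> p_polys p n"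
  shows "diag (V.act F h)"
proof (rule diagI)
  show "V.endo (V.act F h)" by (rule V.endo_act[OF TD_endo[OF F]])
  have "\<exists>m. V.act F h u = m *\<^sub>F u" if u: "(F ^^ (p ^ n)) u = l *\<^sub>F u" for u l
    using h
  proof (induction rule: p_polys.induct)
    case zero
    then show ?case by (intro exI[of _ 0]) simp
  next
    case (step h i c)
    then obtain m where m: "V.act F h u = m *\<^sub>F u" by blast
    have "((F ^^ (p ^ n)) ^^ j) u = (l ^ j) *\<^sub>F u" for j
      by (induction j) (simp_all add: u V.endo_scale[OF V.endo_funpow[OF TD_endo[OF F]]] mult.commute)
    then have "(F ^^ (p ^ n * p ^ (i - n))) u = (l ^ (p ^ (i - n))) *\<^sub>F u"
      by (simp only: funpow_mult)
    moreover have "p ^ n * p ^ (i - n) = p ^ i" using step.hyps by (simp flip: power_add)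
    ultimately have "V.act F (h + monom c (p ^ i)) u = (m + c * l ^ (p ^ (i - n))) *\<^sub>F u"
      by (simp add: V.act_add V.act_monom m V.scale_left_distrib)
    then show ?case by blast
  qed
  then have "{u \<in> carrier A. \<exists>m. (F ^^ (p ^ n)) u = m *\<^sub>F u} \<subseteq> {u \<in> carrier A. \<exists>m. V.act F h u = m *\<^sub>F u}"
    by blast
  then show "carrier A \<subseteq> V.span {u \<in> carrier A. \<exists>m. V.act F h u = m *\<^sub>F u}"
    using power_order_diag[OF F] V.span_mono by blast
qed

text \<open>\<open>h\<close> fixes every eigenvalue, so h(E) and \<open>E\<close> agree on
  eigenvectors. The absence of a linear term is what allows a commutator with \<open>E\<close> to be
  split off each term below, and what makes the class of \<open>E\<close> semisimple.\<close>

lemma diag_eq_act: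
  assumes E: "E \<in> TD" and "diag E"
  shows "\<exists>h\<in>p_polys p 1. V.act E h = E"
proof -
  note endo = TD_endo[OF E]
  obtain M where M: "finite M" "\<And>v. v \<in> carrier A \<Longrightarrow> V.act E (\<Prod>m\<in>M. [:- m, 1:]) v = 0"
    using \<open>diag E\<close> unfolding diag_def by blast
  obtain h where h: "h \<in> p_polys p 1" "\<forall>m\<in>M. poly h m = m"
    using p_polys_interpolate_id[OF M(1) prime_p char_p] by blast
  have "V.act E h v = E v" if "v \<in> carrier A" for v
  proof -
    have "v \<in> V.span {u \<in> carrier A. \<exists>m\<in>M. E u = m *\<^sub>F u}"
      using V.span_eigenvectors_if_act_eq_0[OF endo subspace_A _ M(1) that] M(2) that TD_in_A[OF E] by blast
    then show ?thesis
    proof (induction rule: V.span_induct_alt)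
      case base
      then show ?case by (simp add: V.endo_zero[OF endo] V.endo_zero[OF V.endo_act[OF endo]])
    next
      case (step c x y)
      then obtain m where m: "m \<in> M" "E x = m *\<^sub>F x" by blast
      have "V.act E h x = E x" using V.act_eigenvector[OF endo m(2)] m h(2) by simp
      then show ?case
        using step by (simp add: V.endo_add[OF endo] V.endo_add[OF V.endo_act[OF endo]]
            V.endo_scale[OF endo] V.endo_scale[OF V.endo_act[OF endo]])
    qed
  qed
  then have "V.act E h v = E v" for v
    using TD_res[OF E] TD_res[OF act_TD[OF E h(1)]] res_in_A by metis
  then show ?thesis using h(1) by blast
qed

lemma commutator_TI: "F \<in> TD \<Longrightarrow> Q \<in> range ad \<Longrightarrow> commutator F Q \<in> range ad"
  using commutator_ad by blast

text \<open>As E = h(E), the commutator with \<open>E\<close> is a combination of its own p^i-th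
  powers with i at least 1. So [E, F] = [E, Q], where Q combines the (p^i - 1)-fold commutators of
  \<open>E\<close> with \<open>F\<close>. These are inner because [E, F] is, and
  \<open>F' = F - Q\<close> commutes with \<open>E\<close>. As Q is built from \<open>E\<close> and
  \<open>F\<close>, anything commuting with both commutes with \<open>F'\<close>; this last property
  protects the commutations achieved earlier.\<close>

lemma project_to_centralizer:
  assumes E: "E \<in> TD" "diag E" and F: "F \<in> TD" and EF: "commutator E F \<in> range ad"
  obtains F' where "F' \<in> TD" "cls F' = cls F" "\<And>x. E (F' x) = F' (E x)"
    "\<And>G. \<lbrakk>G \<in> TD; \<And>x. G (E x) = E (G x); \<And>x. G (F x) = F (G x)\<rbrakk> \<Longrightarrow> \<forall>x. G (F' x) = F' (G x)"
proof -
  let ?C = "\<lambda>Q. \<forall>G\<in>TD. (\<forall>x. G (E x) = E (G x)) \<longrightarrow> (\<forall>x. G (F x) = F (G x)) \<longrightarrow> (\<forall>x. G (Q x) = Q (G x))"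
  obtain h where h: "h \<in> p_polys p 1" "V.act E h = E" using diag_eq_act[OF E] by blast
  have "\<exists>Q\<in>range ad. ?C Q \<and> commutator E Q = commutator (V.act E h) F"
    using h(1)
  proof (induction rule: p_polys.induct)
    case zero
    have "ad 0 = (\<lambda>x. 0)" by (auto simp: ad_def)
    moreover have "G 0 = 0" if "G \<in> TD" for G using V.endo_zero[OF TD_endo[OF that]] .
    ultimately show ?case
      by (intro bexI[of _ "ad 0"] rangeI) (auto simp: commutator_def V.endo_zero[OF TD_endo[OF E(1)]] V.endo_zero[OF TD_endo[OF F]])
  next
    case (step h i c)
    then obtain a where a: "?C (ad a)" "commutator E (ad a) = commutator (V.act E h) F" by blast
    have "p ^ i \<ge> 2"
      using step.hyps prime_ge_2_nat[OF prime_p] self_le_power[of p i] by simp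
    \<comment> \<open>Of the \<open>p ^ i - 1\<close> nested commutators in \<open>R\<close>, the
      first produces the inner derivation [E, F] and the remaining \<open>m\<close> keep it
      inner.\<close>
    define m where "m = p ^ i - 2"
    have m: "p ^ i = Suc (Suc m)" using \<open>p ^ i \<ge> 2\<close> by (simp add: m_def)
    define R where "R = (commutator E ^^ Suc m) F"
    have "(commutator E ^^ j) (commutator E F) \<in> range ad" for j
      by (induction j) (auto simp: EF commutator_TI[OF E(1)])
    then have "R \<in> range ad" by (simp add: R_def funpow_swap1)
    then obtain b where b: "R = ad b" by blast
    have "?C ((commutator E ^^ j) F)" for j
      by (induction j) (auto simp: commutator_def V.endo_diff[OF TD_endo])
    then have CR: "?C R" by (simp only: R_def)
    have comm_R: "commutator E R = commutator (E ^^ (p ^ i)) F"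
      using commutator_power_p_power[OF TD_endo[OF E(1)] TD_endo[OF F], of i] by (simp add: R_def m)
    define Q where "Q = (\<lambda>x. ad a x + c *\<^sub>F R x)"
    have "Q = ad (a + c *\<^sub>F b)" by (simp add: Q_def b ad_scale ad_add)
    then have "Q \<in> range ad" by blast
    moreover have "?C Q"
    proof (intro ballI impI allI)
      fix G x assume G: "G \<in> TD" "\<forall>x. G (E x) = E (G x)" "\<forall>x. G (F x) = F (G x)"
      have "G (ad a x) = ad a (G x)" "G (R x) = R (G x)" using a(1) CR G by blast+
      then show "G (Q x) = Q (G x)"
        unfolding Q_def V.endo_add[OF TD_endo[OF G(1)]] V.endo_scale[OF TD_endo[OF G(1)]] by simp
    qed
    moreover have "commutator E Q = commutator (V.act E (h + monom c (p ^ i))) F"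
    proof
      fix x
      have "commutator E Q x = commutator E (ad a) x + c *\<^sub>F commutator E R x"
        unfolding commutator_def Q_def V.endo_add[OF TD_endo[OF E(1)]] V.endo_scale[OF TD_endo[OF E(1)]]
          V.scale_right_diff_distrib by (simp only: algebra_simps)
      also have "\<dots> = commutator (V.act E h) F x + c *\<^sub>F commutator (E ^^ (p ^ i)) F x"
        by (simp only: a(2) comm_R)
      also have "\<dots> = commutator (V.act E (h + monom c (p ^ i))) F x"
        unfolding commutator_def V.act_add V.act_monom V.endo_add[OF TD_endo[OF F]] V.endo_scale[OF TD_endo[OF F]]
          V.scale_right_diff_distrib by (simp only: algebra_simps)
      finally show "commutator E Q x = commutator (V.act E (h + monom c (p ^ i))) F x" .
    qed
    ultimately show ?case by blast
  qed
  then obtain a where a: "?C (ad a)" "commutator E (ad a) = commutator E F" using h(2) by auto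
  define F' where "F' = (\<lambda>x. F x - ad a x)"
  show thesis
  proof
    show "F' \<in> TD" unfolding F'_def by (rule TD_diff[OF F ad_TD])
    show "cls F' = cls F"
      by (rule cls_cong[where a = "0 - a"]) (simp add: F'_def ad_def star_diff_left star_diff_right del: diff_0)
    show "E (F' x) = F' (E x)" for x
      using fun_cong[OF a(2), of x]
      unfolding F'_def commutator_def V.endo_diff[OF TD_endo[OF E(1)]] by (simp add: algebra_simps)
    show "\<forall>x. G (F' x) = F' (G x)"
      if G: "G \<in> TD" "\<And>x. G (E x) = E (G x)" "\<And>x. G (F x) = F (G x)" for G
    proof
      fix x
      have "G (ad a x) = ad a (G x)" using a(1) G by blast
      then show "G (F' x) = F' (G x)"
        unfolding F'_def V.endo_diff[OF TD_endo[OF G(1)]] using G(3) by simp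
    qed
  qed
qed

text \<open>A representative \<open>F\<close> of the new class is corrected against the lifts found
  so far, one after another. Only those lifts have to be diagonalisable for this, so
  \<open>F\<close> itself is made diagonalisable last, by passing to a \<open>p\<close>-polynomial
  in \<open>F\<close>, which still commutes with them and has the same class.\<close>

lemma torus_lift:
  assumes T: "torus H T" and "finite B" "B \<subseteq> T"
  shows "\<exists>D. (\<forall>s\<in>B. D s \<in> TD \<and> cls (D s) = s \<and> diag (D s)) \<and>
    (\<forall>s\<in>B. \<forall>t\<in>B. \<forall>x. D s (D t x) = D t (D s x))"
  using assms(2,3)
proof (induction B rule: finite_induct)
  case empty
  then show ?case by simp
next
  case (insert s B)
  have "B \<subseteq> T" using insert.prems by simp
  from insert.IH[OF this] obtain D where D': "\<forall>t\<in>B. D t \<in> TD \<and> cls (D t) = t \<and> diag (D t)"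
    and comm: "\<forall>t\<in>B. \<forall>u\<in>B. \<forall>x. D t (D u x) = D u (D t x)" by (elim exE conjE)
  have D: "D t \<in> TD" "cls (D t) = t" "diag (D t)" if "t \<in> B" for t
    using D' that by simp_all
  have D_comm: "D t (D u x) = D u (D t x)" if "t \<in> B" "u \<in> B" for t u x
    using comm that by simp
  have T_H: "T \<subseteq> carrier H" using T unfolding torus_def restricted_subalgebra_def by blast
  have "\<exists>F\<in>TD. cls F = s \<and> (\<forall>t\<in>C. \<forall>x. D t (F x) = F (D t x))" if "finite C" "C \<subseteq> B" for C
    using that
  proof (induction C rule: finite_induct)
    case empty
    then show ?case using T_H insert.prems carrier_H by auto
  next
    case (insert t C)
    then obtain F where F: "F \<in> TD" "cls F = s" "\<And>u x. u \<in> C \<Longrightarrow> D u (F x) = F (D u x)" by blast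
    have t: "t \<in> B" using insert by blast
    have "t \<otimes>\<^bsub>H\<^esub> s = \<zero>\<^bsub>H\<^esub>"
      using T \<open>insert s B \<subseteq> T\<close> t unfolding torus_def by blast
    then have "cls (commutator (D t) F) = cls (\<lambda>x. 0)"
      using mult_H[OF D(1)[OF t] F(1)] D(2)[OF t] F(2) zero_H by simp
    then obtain a where "\<And>x. commutator (D t) F x = 0 + ad a x"
      using cls_eqD[OF TD_commutator[OF D(1)[OF t] F(1)] TD_zero] by blast
    then have "commutator (D t) F = ad a" by (simp add: fun_eq_iff)
    then have "commutator (D t) F \<in> range ad" by blast
    then obtain F' where F': "F' \<in> TD" "cls F' = cls F" "\<And>x. D t (F' x) = F' (D t x)"
      "\<And>G. \<lbrakk>G \<in> TD; \<And>x. G (D t x) = D t (G x); \<And>x. G (F x) = F (G x)\<rbrakk> \<Longrightarrow> \<forall>x. G (F' x) = F' (G x)"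
      using project_to_centralizer[OF D(1)[OF t] D(3)[OF t] F(1)] by blast
    have "D u (F' x) = F' (D u x)" if "u \<in> C" for u x
    proof -
      have u: "u \<in> B" using that insert.prems by blast
      show ?thesis
        using F'(4)[OF D(1)[OF u] D_comm[OF u t] F(3)[OF that]] by blast
    qed
    then show ?case using F' F(2) by (intro bexI[of _ F']) auto
  qed
  from this[OF insert.hyps(1)] obtain F where
    F: "F \<in> TD" "cls F = s" "\<And>t x. t \<in> B \<Longrightarrow> D t (F x) = F (D t x)" by blast
  have "semisimple_elem H (cls F)"
    using T insert.prems F(2) unfolding torus_def by blast
  then obtain h where h: "h \<in> p_polys p n" "cls F = cls (V.act F h)"
    using semisimple_eq_act[OF F(1)] by blast
  define D'' where "D'' = D(s := V.act F h)"
  have "D t (V.act F h x) = V.act F h (D t x)" if "t \<in> B" for t x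
    using V.act_commute[OF TD_endo[OF F(1)] TD_endo[OF D(1)]] F(3) that by blast
  then show ?case
    using D D_comm insert.hyps h diag_act[OF F(1) h(1)] act_TD[OF F(1) h(1)] F(2)
    by (intro exI[of _ D'']) (auto simp: D''_def)
qed

lemma common_eigenvectors_span:
  assumes "finite B" "\<And>s. s \<in> B \<Longrightarrow> D s \<in> TD" "\<And>s. s \<in> B \<Longrightarrow> diag (D s)"
    "\<And>s t x. s \<in> B \<Longrightarrow> t \<in> B \<Longrightarrow> D s (D t x) = D t (D s x)"
  shows "carrier A \<subseteq> V.span {u \<in> carrier A. \<forall>s\<in>B. \<exists>l. D s u = l *\<^sub>F u}"
  using assms
proof (induction B rule: finite_induct)
  case empty
  then show ?case using V.span_superset by auto
next
  case (insert s B)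
  have joint: "u \<in> V.span {u \<in> carrier A. \<forall>s\<in>insert s B. \<exists>l. D s u = l *\<^sub>F u}"
    if uA: "u \<in> carrier A" and eig: "\<forall>s\<in>B. \<exists>l. D s u = l *\<^sub>F u" for u
  proof -
    obtain l where l: "\<And>t. t \<in> B \<Longrightarrow> D t u = l t *\<^sub>F u" using bchoice[OF eig] by blast
    \<comment> \<open>The joint eigenspace containing \<open>u\<close>. Commutation makes it stable
      under \<open>D s\<close>, which is therefore diagonalisable on it.\<close>
    define S where "S = {v \<in> carrier A. \<forall>t\<in>B. D t v = l t *\<^sub>F v}"
    have Ds: "D s \<in> TD" "diag (D s)" using insert.prems by auto
    have "V.subspace S"
      unfolding V.subspace_def
    proof (intro conjI ballI allI)
      show "0 \<in> S"
        using insert.prems(1) by (auto simp: S_def A_closed V.endo_zero[OF TD_endo])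
      fix x y c assume "x \<in> S"
      then show "c *\<^sub>F x \<in> S"
        using insert.prems(1) by (auto simp: S_def A_closed V.endo_scale[OF TD_endo] mult.commute)
      assume "y \<in> S"
      with \<open>x \<in> S\<close> show "x + y \<in> S"
        using insert.prems(1) by (auto simp: S_def A_closed V.endo_add[OF TD_endo] V.scale_right_distrib)
    qed
    moreover have "D s v \<in> S" if "v \<in> S" for v
    proof -
      have "D t (D s v) = l t *\<^sub>F D s v" if "t \<in> B" for t
      proof -
        have "D t (D s v) = D s (D t v)" using insert.prems(3) that by blast
        then show ?thesis
          using \<open>v \<in> S\<close> that V.endo_scale[OF TD_endo[OF Ds(1)]] by (simp add: S_def)
      qed
      then show ?thesis using TD_in_A[OF Ds(1)] by (simp add: S_def)
    qed
    ultimately have "S \<subseteq> V.span {v \<in> S. \<exists>m. D s v = m *\<^sub>F v}"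
      using diag_invariant_subspace[OF TD_endo[OF Ds(1)] Ds(2), of S] by (auto simp: S_def)
    moreover have "{v \<in> S. \<exists>m. D s v = m *\<^sub>F v} \<subseteq> {u \<in> carrier A. \<forall>s\<in>insert s B. \<exists>l. D s u = l *\<^sub>F u}"
      by (auto simp: S_def)
    moreover have "u \<in> S" using uA l by (auto simp: S_def)
    ultimately show ?thesis by (meson V.span_mono subsetD)
  qed
  then have "{u \<in> carrier A. \<forall>s\<in>B. \<exists>l. D s u = l *\<^sub>F u}
      \<subseteq> V.span {u \<in> carrier A. \<forall>s\<in>insert s B. \<exists>l. D s u = l *\<^sub>F u}"
    by (intro subsetI joint) auto
  then have "V.span {u \<in> carrier A. \<forall>s\<in>B. \<exists>l. D s u = l *\<^sub>F u}
      \<subseteq> V.span {u \<in> carrier A. \<forall>s\<in>insert s B. \<exists>l. D s u = l *\<^sub>F u}"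
    by (rule V.span_minimal[OF _ V.subspace_span])
  moreover have "carrier A \<subseteq> V.span {u \<in> carrier A. \<forall>s\<in>B. \<exists>l. D s u = l *\<^sub>F u}"
    using insert.IH insert.prems by blast
  ultimately show ?case by blast
qed

section \<open>The upper bound\<close>

text \<open>Here \<open>range of_nat\<close> is the prime field. These functions form a finite space
  closed under translation by P, on which fixed points can be counted although \<open>'k\<close> is
  infinite.\<close>

definition prime_funs :: "('g \<Rightarrow> 'k) set" where
  "prime_funs = {c. (\<forall>g\<in>carrier P. c g \<in> range of_nat) \<and> (\<forall>g. g \<notin> carrier P \<longrightarrow> c g = 0)}"

lemma finite_prime_funs: "finite prime_funs"
proof -
  have "range (of_nat :: nat \<Rightarrow> 'k) \<subseteq> of_nat ` {..<p}"
  proof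
    fix x :: 'k assume "x \<in> range of_nat"
    then obtain m where "x = of_nat m" by blast
    also have "m = m mod p + p * (m div p)" by simp
    also have "of_nat (m mod p + p * (m div p)) = (of_nat (m mod p) :: 'k)"
      unfolding of_nat_add of_nat_mult using char_p of_nat_CHAR[where ?'a = 'k] by simp
    finally have "x = of_nat (m mod p)" .
    then show "x \<in> of_nat ` {..<p}" using p_pos by auto
  qed
  then have "finite (range (of_nat :: nat \<Rightarrow> 'k))" by (rule finite_subset) simp
  then show ?thesis
    using finite_set_of_finite_funs[OF finite_P, of "range (of_nat :: nat \<Rightarrow> 'k)" 0]
    by (rule_tac finite_subset) (auto simp: prime_funs_def)
qed

lemma zero_prime_funs: "0 \<in> prime_funs"
  using rangeI[of "of_nat :: nat \<Rightarrow> 'k" 0] by (simp add: prime_funs_def zero_fun_apply del: range_eqI)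

lemma add_prime_funs: "c \<in> prime_funs \<Longrightarrow> d \<in> prime_funs \<Longrightarrow> c + d \<in> prime_funs"
  by (auto simp: prime_funs_def plus_fun_apply image_iff) (metis of_nat_add)

text \<open>The functional is a vector fixed by \<open>P \<times> P\<close> in the finite \<open>\<bbbF>\<^sub>p\<close>-space of functions
  \<open>(g, h, x) \<mapsto> \<phi> (g F(x) h\<inverse>)\<close>, where \<open>\<phi>\<close> runs through the combinations of coefficient
  functionals with coefficients in the prime field.\<close>

lemma invariant_functional:
  assumes F: "F \<in> TD" and "F x0 \<noteq> 0"
  obtains \<phi> :: "('g \<Rightarrow> 'k) \<Rightarrow> 'k" where
    "\<And>x y. \<phi> (x + y) = \<phi> x + \<phi> y" "\<And>c x. \<phi> (c *\<^sub>F x) = c * \<phi> x"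
    "\<And>g x. g \<in> carrier P \<Longrightarrow> \<phi> (delta g \<star> F x) = \<phi> (F x)"
    "\<And>g x. g \<in> carrier P \<Longrightarrow> \<phi> (F x \<star> delta g) = \<phi> (F x)"
    "\<exists>x. \<phi> (F x) \<noteq> 0"
proof -
  define ev where "ev c y = (\<Sum>u\<in>carrier P. c u * y u)" for c y :: "'g \<Rightarrow> 'k"
  \<comment> \<open>The count runs over the value tables \<open>K c\<close> and not over the
    coefficients \<open>c\<close>: a nonzero invariant \<open>c\<close> may vanish on the image of
    \<open>F\<close>, whereas a nonzero invariant table gives a functional that does not.\<close>
  define K where "K c = (\<lambda>(g, h, x). if g \<in> carrier P \<and> h \<in> carrier P
    then ev c (delta g \<star> F x \<star> delta (inv h)) else 0)" for c
  define f where "f = (\<lambda>(k, l) K (g, h, x). if g \<in> carrier P \<and> h \<in> carrier P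
    then K (inv k \<otimes> g, inv l \<otimes> h, x :: 'g \<Rightarrow> 'k) else (0 :: 'k))"
  have K_add: "K c + K d = K (c + d)" for c d
    by (auto simp: K_def ev_def fun_eq_iff plus_fun_apply distrib_right sum.distrib)
  have K_0: "K 0 = 0"
    by (auto simp: K_def ev_def fun_eq_iff zero_fun_apply)
  have ev_trans: "ev c (delta a \<star> y \<star> delta b) = ev (\<lambda>w. if w \<in> carrier P then c (a \<otimes> w \<otimes> b) else 0) y"
    if ab: "a \<in> carrier P" "b \<in> carrier P" for a b c y
  proof -
    have "ev c (delta a \<star> y \<star> delta b) = (\<Sum>u\<in>carrier P. c u * y (inv a \<otimes> (u \<otimes> inv b)))"
      unfolding ev_def using ab by (intro sum.cong) (auto simp: delta_star star_delta)
    also have "\<dots> = (\<Sum>w\<in>carrier P. c (a \<otimes> w \<otimes> b) * y w)"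
      using ab
      by (intro sum.reindex_bij_witness[of _ "\<lambda>w. a \<otimes> w \<otimes> b" "\<lambda>u. inv a \<otimes> (u \<otimes> inv b)"])
         (auto simp: m_assoc inv_cancel)
    finally show ?thesis by (simp add: ev_def)
  qed
  have K_trans: "f (k, l) (K c) = K (\<lambda>w. if w \<in> carrier P then c (inv k \<otimes> w \<otimes> l) else 0)"
    if kl: "k \<in> carrier P" "l \<in> carrier P" for k l c
  proof
    fix z :: "'g \<times> 'g \<times> ('g \<Rightarrow> 'k)"
    obtain g h x where z: "z = (g, h, x)" by (metis surj_pair)
    show "f (k, l) (K c) z = K (\<lambda>w. if w \<in> carrier P then c (inv k \<otimes> w \<otimes> l) else 0) z"
    proof (cases "g \<in> carrier P \<and> h \<in> carrier P")
      case True
      then have eq: "delta (inv k \<otimes> g) \<star> F x \<star> delta (inv (inv l \<otimes> h))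
          = delta (inv k) \<star> (delta g \<star> F x \<star> delta (inv h)) \<star> delta l"
        using kl by (simp add: inv_mult_group delta_delta[symmetric] star_assoc)
      show ?thesis
        using True kl ev_trans[of "inv k" l c] by (simp add: z f_def K_def eq)
    qed (auto simp: z f_def K_def)
  qed
  let ?X = "K ` prime_funs"
  obtain u where u: "u \<in> carrier P" "F x0 u \<noteq> 0"
    using TD_in_A[OF F, of x0] \<open>F x0 \<noteq> 0\<close> by (auto simp: carrier_A fun_eq_iff zero_fun_apply)
  have "delta u \<in> prime_funs"
    using rangeI[of "of_nat :: nat \<Rightarrow> 'k" 0] rangeI[of "of_nat :: nat \<Rightarrow> 'k" 1] u
    by (auto simp: prime_funs_def delta_def)
  have "ev (delta u) y = y u" for y
  proof -
    have "ev (delta u) y = (\<Sum>v\<in>carrier P. if v = u then y u else 0)"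
      unfolding ev_def by (intro sum.cong) (auto simp: delta_def)
    then show ?thesis using u finite_P by simp
  qed
  then have "K (delta u) (\<one>, \<one>, x0) \<noteq> 0"
    using u TD_in_A[OF F] by (simp add: K_def)
  then have K_u: "K (delta u) \<in> ?X" "K (delta u) \<noteq> 0"
    using \<open>delta u \<in> prime_funs\<close> by (auto simp: zero_fun_apply)
  have order_PP: "Coset.order (P \<times>\<times> P) = p ^ (n + n)"
    using order_P by (simp add: Coset.order_def card_cartesian_product power_add)
  obtain K' where K': "K' \<in> ?X" "K' \<noteq> 0" "\<And>kl. kl \<in> carrier (P \<times>\<times> P) \<Longrightarrow> f kl K' = K'"
  proof (rule p_group_nonzero_fixed_point[OF _ _ order_PP prime_p char_p, of ?X "K (delta u)" f])
    show "group (P \<times>\<times> P)" by (rule DirProd_group) (rule group_axioms)+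
    show "finite (carrier (P \<times>\<times> P))" using finite_P by simp
    show "finite ?X" using finite_prime_funs by simp
    show "0 \<in> ?X" using K_0 zero_prime_funs by (metis imageI)
    show "x + y \<in> ?X" if "x \<in> ?X" "y \<in> ?X" for x y
      using that K_add add_prime_funs by auto
    show "K (delta u) \<in> ?X" "K (delta u) \<noteq> 0" using K_u by auto
    show "f kl x \<in> ?X" if kl: "kl \<in> carrier (P \<times>\<times> P)" and x: "x \<in> ?X" for kl x
    proof -
      obtain k l where k: "kl = (k, l)" "k \<in> carrier P" "l \<in> carrier P" using kl by auto
      obtain c where c: "c \<in> prime_funs" "x = K c" using x by blast
      have "(\<lambda>w. if w \<in> carrier P then c (inv k \<otimes> w \<otimes> l) else 0) \<in> prime_funs"
        using c(1) k by (auto simp: prime_funs_def)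
      then show ?thesis using K_trans k c by simp
    qed
    show "f \<one>\<^bsub>P \<times>\<times> P\<^esub> x = x" if "x \<in> ?X" for x
      using that by (auto simp: f_def K_def fun_eq_iff)
    show "f (kl \<otimes>\<^bsub>P \<times>\<times> P\<^esub> kl') x = f kl (f kl' x)"
      if "kl \<in> carrier (P \<times>\<times> P)" "kl' \<in> carrier (P \<times>\<times> P)" "x \<in> ?X" for kl kl' x
      using that by (auto simp: f_def fun_eq_iff inv_mult_group m_assoc)
    show "f kl 0 = 0" if "kl \<in> carrier (P \<times>\<times> P)" for kl
      using that by (auto simp: f_def fun_eq_iff zero_fun_apply)
  qed blast
  obtain c where c: "K' = K c" using K'(1) by blast
  \<comment> \<open>Translating by the pair (g, h) and evaluating at the same pair leads back to the
    identity.\<close>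
  have inv: "K c (g, h, x) = K c (\<one>, \<one>, x)" if "g \<in> carrier P" "h \<in> carrier P" for g h x
  proof -
    have "f (g, h) (K c) (g, h, x) = K c (g, h, x)" using K'(3)[of "(g, h)"] c that by simp
    then show ?thesis using that by (simp add: f_def)
  qed
  show thesis
  proof
    show "ev c (x + y) = ev c x + ev c y" for x y
      by (simp add: ev_def plus_fun_apply distrib_left sum.distrib)
    show "ev c (d *\<^sub>F x) = d * ev c x" for d x
      by (simp add: ev_def fun_scale_apply sum_distrib_left mult.left_commute)
    show "ev c (delta g \<star> F x) = ev c (F x)" if "g \<in> carrier P" for g x
      using inv[OF that one_closed, of x] that TD_in_A[OF F] by (simp add: K_def)
    show "ev c (F x \<star> delta g) = ev c (F x)" if "g \<in> carrier P" for g x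
      using inv[OF one_closed inv_closed[OF that], of x] that TD_in_A[OF F] by (simp add: K_def)
    show "\<exists>x. ev c (F x) \<noteq> 0"
    proof -
      have "\<exists>g h x. K c (g, h, x) \<noteq> 0" using K'(2) c by (auto simp: fun_eq_iff zero_fun_apply)
      then obtain g h x where ghx: "K c (g, h, x) \<noteq> 0" by blast
      then have "g \<in> carrier P" "h \<in> carrier P" by (auto simp: K_def split: if_splits)
      then have "K c (\<one>, \<one>, x) \<noteq> 0" using inv[of g h x] ghx by metis
      then show ?thesis using TD_in_A[OF F] by (auto simp: K_def)
    qed
  qed
qed

text \<open>These elements span the square of the augmentation ideal.\<close>

definition aug_products :: "('g \<Rightarrow> 'k) set" where
  "aug_products = {(delta g - delta \<one>) \<star> (delta h - delta \<one>) | g h. g \<in> carrier P \<and> h \<in> carrier P}"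

lemma derivation_eq_zero:
  assumes F: "F \<in> TD" and span: "carrier A \<subseteq> V.span (aug_products \<union> Y)" and Y: "\<And>y. y \<in> Y \<Longrightarrow> F y = 0"
  shows "F x = 0"
proof (rule ccontr)
  assume "F x \<noteq> 0"
  then show False
  proof (rule invariant_functional[OF F])
    fix \<phi> :: "('g \<Rightarrow> 'k) \<Rightarrow> 'k"
    assume \<phi>:
    "\<And>x y. \<phi> (x + y) = \<phi> x + \<phi> y" "\<And>c x. \<phi> (c *\<^sub>F x) = c * \<phi> x"
    "\<And>g x. g \<in> carrier P \<Longrightarrow> \<phi> (delta g \<star> F x) = \<phi> (F x)"
    "\<And>g x. g \<in> carrier P \<Longrightarrow> \<phi> (F x \<star> delta g) = \<phi> (F x)"
    "\<exists>x. \<phi> (F x) \<noteq> 0"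
  have \<phi>0: "\<phi> 0 = 0" using \<phi>(2)[of 0 0] by simp
  have \<phi>_diff: "\<phi> (x - y) = \<phi> x - \<phi> y" for x y using \<phi>(1)[of "x - y" y] by simp
  have base: "\<phi> (F w) = 0" if w: "w \<in> aug_products \<union> Y" for w
  proof (cases "w \<in> Y")
    case True
    then show ?thesis using Y \<phi>0 by simp
  next
    case False
    then obtain g h where gh: "g \<in> carrier P" "h \<in> carrier P"
      "w = (delta g - delta \<one>) \<star> (delta h - delta \<one>)" using w by (auto simp: aug_products_def)
    \<comment> \<open>These are the two kinds of Leibniz terms of \<open>F w\<close>; left and right
      invariance of \<phi> kill one each.\<close>
    have "\<phi> (F u \<star> (delta h - delta \<one>)) = 0" "\<phi> ((delta g - delta \<one>) \<star> F u) = 0" for u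
      using \<phi>(3)[OF gh(1)] \<phi>(4)[OF gh(2)] TD_in_A[OF F]
      by (simp_all add: star_diff_left star_diff_right \<phi>_diff)
    then show ?thesis unfolding gh(3) TD_star[OF F] \<phi>(1) by simp
  qed
  have "\<phi> (F w) = 0" if "w \<in> carrier A" for w
  proof -
    have "w \<in> V.span (aug_products \<union> Y)" using that span by blast
    then show ?thesis
      by (induction rule: V.span_induct_alt)
         (simp_all add: V.endo_zero[OF TD_endo[OF F]] V.endo_add[OF TD_endo[OF F]]
           V.endo_scale[OF TD_endo[OF F]] \<phi>0 \<phi>(1,2) base)
  qed
  then show False using \<phi>(5) TD_res[OF F] res_in_A by metis
  qed
qed

text \<open>From gh - 1 = (g - 1) + (h - 1) + (g - 1)(h - 1), the map sending g to g - 1 is additive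
  modulo the products, so induction over the generated subgroup reaches every group element;
  inverses come from the case gh = 1.\<close>

lemma A_subset_span_generators:
  assumes S: "S \<subseteq> carrier P" "generate P S = carrier P"
  shows "carrier A \<subseteq> V.span (aug_products \<union> insert (delta \<one>) ((\<lambda>s. delta s - delta \<one>) ` S))"
    (is "_ \<subseteq> V.span ?W")
proof -
  note base = V.span_base[of _ ?W] and closed = V.span_add[of _ ?W] V.span_diff[of _ ?W]
  have one: "delta \<one> \<in> V.span ?W" by (rule base) simp
  have prod: "(delta g - delta \<one>) \<star> (delta h - delta \<one>) = delta (g \<otimes> h) - delta g - delta h + delta \<one>"
    if "g \<in> carrier P" "h \<in> carrier P" for g h
    using that by (simp add: star_diff_left delta_delta delta_in_A A_closed) (simp add: star_diff_right delta_delta delta_in_A)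
  have prod_mem: "(delta g - delta \<one>) \<star> (delta h - delta \<one>) \<in> V.span ?W"
    if "g \<in> carrier P" "h \<in> carrier P" for g h
    using that by (intro base) (auto simp: aug_products_def)
  have gen: "delta g \<in> V.span ?W" if "g \<in> generate P S" for g
    using that
  proof (induction rule: generate.induct)
    case one
    then show ?case by (rule \<open>delta \<one> \<in> V.span ?W\<close>)
  next
    case (incl s)
    have "delta s - delta \<one> \<in> V.span ?W" using incl by (intro base) simp
    from V.span_add[OF this one] show ?case by (simp only: diff_add_cancel)
  next
    case (inv s)
    have s: "s \<in> carrier P" using inv S by blast
    have "delta s - delta \<one> \<in> V.span ?W" using inv by (intro base) simp
    moreover have "delta (inv s)
        = delta \<one> - (delta s - delta \<one>) - (delta s - delta \<one>) \<star> (delta (inv s) - delta \<one>)"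
      using prod[OF s inv_closed[OF s]] s by simp
    ultimately show ?case using prod_mem[OF s inv_closed[OF s]] one closed by metis
  next
    case (eng g h)
    have gh: "g \<in> carrier P" "h \<in> carrier P" using eng.hyps S(2) by auto
    have "delta (g \<otimes> h) = (delta g - delta \<one>) \<star> (delta h - delta \<one>) + delta g + delta h - delta \<one>"
      using prod[OF gh] by simp
    then show ?case using prod_mem[OF gh] eng.IH one closed by metis
  qed
  have "delta ` carrier P \<subseteq> V.span ?W" using gen S(2) by auto
  then have "V.span (delta ` carrier P) \<subseteq> V.span ?W"
    by (rule V.span_minimal[OF _ V.subspace_span])
  then show ?thesis using A_subset_span_delta by blast
qed

text \<open>A basis \<open>W\<close> of the span of 1 and the products is extended by common
  eigenvectors \<open>Y\<close> to a basis of the group algebra, and comparison with the generators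
  gives \<open>card Y \<le> card S\<close>. Were \<open>B\<close> larger, some nontrivial
  combination of the lifts would have eigenvalue 0 on all of \<open>Y\<close>, hence vanish by
  \<open>derivation_eq_zero\<close>, against independence. The generating set \<open>S\<close> is
  arbitrary, so the choice \<open>S = carrier P\<close> also bounds independent sets before any
  basis is known to exist.\<close>

lemma torus_independent_card_le:
  assumes T: "torus H T" and S: "S \<subseteq> carrier P" "finite S" "generate P S = carrier P"
    and B: "finite B" "B \<subseteq> T" "lin_independent H B"
  shows "card B \<le> card S"
proof (rule ccontr)
  assume "\<not> card B \<le> card S"
  obtain D where D: "\<forall>s\<in>B. D s \<in> TD \<and> cls (D s) = s \<and> diag (D s)"
    and comm: "\<forall>s\<in>B. \<forall>t\<in>B. \<forall>x. D s (D t x) = D t (D s x)"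
    using torus_lift[OF T B(1,2)] by (elim exE conjE)
  define Eig where "Eig = {u \<in> carrier A. \<forall>s\<in>B. \<exists>l. D s u = l *\<^sub>F u}"
  have Eig: "carrier A \<subseteq> V.span Eig"
    unfolding Eig_def using common_eigenvectors_span[of B D] B(1) D comm by simp
  obtain W where W: "W \<subseteq> insert (delta \<one>) aug_products" "V.independent W"
    "insert (delta \<one>) aug_products \<subseteq> V.span W"
    using V.maximal_independent_subset by blast
  obtain C where C: "W \<subseteq> C" "C \<subseteq> W \<union> Eig" "V.independent C" "W \<union> Eig \<subseteq> V.span C"
    using V.maximal_independent_subset_extend[of W "W \<union> Eig"] W(2) by blast
  define Y where "Y = C - W"
  have "W \<subseteq> carrier A"
    using W(1) delta_in_A[of \<one>] by (auto simp: aug_products_def)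
  then have finite_C: "finite C" if "C \<subseteq> carrier A"
    using V.independent_span_bound[of "delta ` carrier P" C] A_subset_span_delta finite_P C(3) that by blast
  have CA: "C \<subseteq> carrier A" using C(2) \<open>W \<subseteq> carrier A\<close> by (auto simp: Eig_def)
  have finC: "finite C" using finite_C[OF CA] .
  have finW: "finite W" using finC C(1) finite_subset by blast
  let ?S = "(\<lambda>s. delta s - delta \<one>) ` S"
  have "C \<subseteq> V.span (W \<union> ?S)"
  proof -
    have "insert (delta \<one>) aug_products \<subseteq> V.span (W \<union> ?S)"
      using W(3) V.span_mono[of W "W \<union> ?S"] by blast
    moreover have "?S \<subseteq> V.span (W \<union> ?S)" by (auto intro!: V.span_base)
    ultimately have "aug_products \<union> insert (delta \<one>) ?S \<subseteq> V.span (W \<union> ?S)" by blast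
    then have "V.span (aug_products \<union> insert (delta \<one>) ?S) \<subseteq> V.span (W \<union> ?S)"
      by (rule V.span_minimal[OF _ V.subspace_span])
    then show ?thesis using A_subset_span_generators[OF S(1,3)] CA by blast
  qed
  then have "card C \<le> card (W \<union> ?S)"
    using V.independent_span_bound[of "W \<union> ?S" C] finW S(2) C(3) by simp
  also have "\<dots> \<le> card W + card ?S" by (rule card_Un_le)
  also have "\<dots> \<le> card W + card S" using card_image_le[OF S(2)] by simp
  finally have "card Y \<le> card S"
    using C(1) finW by (simp add: Y_def card_Diff_subset)
  then have "card Y < card B" using \<open>\<not> card B \<le> card S\<close> by simp
  have "Y \<subseteq> Eig" using C(2) by (auto simp: Y_def)
  then have eig: "\<forall>y\<in>Y. \<forall>s\<in>B. \<exists>l. D s y = l *\<^sub>F y" by (auto simp: Eig_def)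
  define l where "l s y = (SOME a. D s y = a *\<^sub>F y)" for s y
  have l: "D s y = l s y *\<^sub>F y" if "y \<in> Y" "s \<in> B" for y s
    unfolding l_def by (rule someI_ex) (use eig that in blast)
  have "finite Y" using finC by (simp add: Y_def)
  obtain c where c: "\<exists>s\<in>B. c s \<noteq> 0" "\<forall>y\<in>Y. (\<Sum>s\<in>B. c s * l s y) = 0"
    using homogeneous_system[OF \<open>finite Y\<close> B(1) \<open>card Y < card B\<close>] by blast
  define F where "F = (\<lambda>x. \<Sum>s\<in>B. c s *\<^sub>F D s x)"
  have F: "F \<in> TD"
    unfolding F_def using D by (intro TD_sum B(1) TD_scale) auto
  have FY: "F y = 0" if "y \<in> insert (delta \<one>) Y" for y
  proof (cases "y = delta \<one>")
    case True
    then show ?thesis using TD_delta_one[OF F] by simp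
  next
    case False
    then have y: "y \<in> Y" using that by simp
    have "F y = (\<Sum>s\<in>B. (c s * l s y) *\<^sub>F y)"
      unfolding F_def by (intro sum.cong) (simp_all add: l[OF y])
    also have "\<dots> = 0" using c(2) y by (simp flip: V.scale_sum_left)
    finally show ?thesis .
  qed
  have "carrier A \<subseteq> V.span (aug_products \<union> insert (delta \<one>) Y)"
  proof -
    have "C \<subseteq> aug_products \<union> insert (delta \<one>) Y" using W(1) by (auto simp: Y_def)
    then have "V.span C \<subseteq> V.span (aug_products \<union> insert (delta \<one>) Y)" by (rule V.span_mono)
    moreover have "V.span Eig \<subseteq> V.span C"
      using C(4) by (intro V.span_minimal V.subspace_span) simp
    ultimately show ?thesis using Eig by blast
  qed
  then have "F x = 0" for x
    using derivation_eq_zero[OF F] FY by blast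
  then have "F = (\<lambda>x. 0)" by blast
  then have "lin_comb H c B = \<zero>\<^bsub>H\<^esub>"
    using lin_comb_H[of B D c] B(1) D unfolding F_def zero_H by simp
  then show False
    using B(1,3) c(1) unfolding lin_independent_def by blast
qed

section \<open>The torus of additive characters\<close>

definition additive_characters :: "('g \<Rightarrow> 'k) set" where
  "additive_characters = {f. (\<forall>g\<in>carrier P. \<forall>h\<in>carrier P. f (g \<otimes> h) = f g + f h)
    \<and> (\<forall>g. g \<notin> carrier P \<longrightarrow> f g = 0)}"

lemma range_of_nat_diff:
  fixes x y :: 'k
  assumes "x \<in> range of_nat" "y \<in> range of_nat"
  shows "x - y \<in> range of_nat"
proof -
  obtain a b where ab: "x = of_nat a" "y = of_nat b" using assms by blast
  \<comment> \<open>A natural number that represents - b in the prime field.\<close>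
  have "of_nat (p * b - b) = (of_nat (p * b) - of_nat b :: 'k)"
    using p_pos by (intro of_nat_diff) simp
  also have "\<dots> = - of_nat b"
    using of_nat_CHAR[where ?'a = 'k] char_p by simp
  finally have "x - y = of_nat (a + (p * b - b))" by (simp add: ab)
  then show ?thesis by blast
qed

text \<open>A fixed vector of \<open>P\<close> among the functions that vanish at \<open>\<one>\<close> and are constant on the cosets
  \<open>Qg\<close>, for the action \<open>(x \<cdot> c)(g) = c(gx) - c(x)\<close>, is an additive character.\<close>

lemma additive_character_vanishing_on:
  assumes Q: "subgroup Q P" "Q \<noteq> carrier P"
  obtains f where "f \<in> additive_characters" "f \<noteq> 0" "\<And>h. h \<in> Q \<Longrightarrow> f h = 0"
proof -
  define X where "X = {c \<in> prime_funs. (\<forall>h\<in>Q. \<forall>g\<in>carrier P. c (h \<otimes> g) = c g) \<and> c \<one> = 0}"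
  define act where "act x c = (\<lambda>g. if g \<in> carrier P then c (g \<otimes> x) - c x else (0 :: 'k))" for x c
  \<comment> \<open>The indicator of the complement of \<open>Q\<close>: nonzero because
    \<open>Q\<close> is proper, zero at the identity, and constant on the cosets of
    \<open>Q\<close>.\<close>
  define c0 where "c0 = (\<lambda>g. if g \<in> carrier P \<and> g \<notin> Q then 1 else (0 :: 'k))"
  note Q_sub = subgroup.subset[OF Q(1)] and Q_closed = subgroup.m_closed[OF Q(1)]
    and Q_inv = subgroup.m_inv_closed[OF Q(1)] and Q_one = subgroup.one_closed[OF Q(1)]
  obtain g0 where g0: "g0 \<in> carrier P" "g0 \<notin> Q" using Q Q_sub by blast
  have c0_range: "c0 g \<in> range of_nat" for g
    using rangeI[of "of_nat :: nat \<Rightarrow> 'k" 0] rangeI[of "of_nat :: nat \<Rightarrow> 'k" 1] by (simp add: c0_def)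
  have Q_mult: "h \<otimes> g \<in> Q \<longleftrightarrow> g \<in> Q" if "h \<in> Q" "g \<in> carrier P" for h g
  proof
    assume "h \<otimes> g \<in> Q"
    then have "inv h \<otimes> (h \<otimes> g) \<in> Q" using Q_inv[OF that(1)] Q_closed by blast
    then show "g \<in> Q" using that Q_sub by (simp add: inv_cancel subsetD)
  qed (use that Q_closed in blast)
  have c0: "c0 \<in> X" "c0 \<noteq> 0"
  proof -
    have "c0 (h \<otimes> g) = c0 g" if "h \<in> Q" "g \<in> carrier P" for h g
      using Q_mult[OF that] that Q_sub by (auto simp: c0_def)
    then show "c0 \<in> X"
      using c0_range Q_one by (auto simp: X_def prime_funs_def) (auto simp: c0_def)
    show "c0 \<noteq> 0" using g0 by (auto simp: c0_def fun_eq_iff zero_fun_apply)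
  qed
  obtain f where f: "f \<in> X" "f \<noteq> 0" "\<And>x. x \<in> carrier P \<Longrightarrow> act x f = f"
  proof (rule p_group_nonzero_fixed_point[OF group_axioms finite_P order_P prime_p char_p, of X c0 act])
    show "finite X" using finite_prime_funs by (simp add: X_def)
    show "0 \<in> X" using zero_prime_funs by (simp add: X_def zero_fun_apply)
    show "x + y \<in> X" if "x \<in> X" "y \<in> X" for x y
      using that add_prime_funs by (auto simp: X_def plus_fun_apply)
    show "c0 \<in> X" "c0 \<noteq> 0" by (fact c0)+
    show "act x c \<in> X" if x: "x \<in> carrier P" and c: "c \<in> X" for x c
    proof -
      have "act x c \<in> prime_funs"
        using x c range_of_nat_diff by (auto simp: X_def prime_funs_def act_def)
      moreover have "act x c (h \<otimes> g) = act x c g" if "h \<in> Q" "g \<in> carrier P" for h g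
        using that x c Q_sub by (auto simp: X_def act_def m_assoc subsetD)
      ultimately show ?thesis using x by (simp add: X_def) (simp add: act_def)
    qed
    show "act \<one> c = c" if "c \<in> X" for c
      using that by (auto simp: X_def prime_funs_def act_def)
    show "act (x \<otimes> y) c = act x (act y c)" if "x \<in> carrier P" "y \<in> carrier P" "c \<in> X" for x y c
      using that by (auto simp: act_def m_assoc)
    show "act x 0 = 0" if "x \<in> carrier P" for x
      by (auto simp: act_def fun_eq_iff zero_fun_apply)
  qed blast
  have add: "f (g \<otimes> x) = f g + f x" if "g \<in> carrier P" "x \<in> carrier P" for g x
    using fun_cong[OF f(3)[OF that(2)], of g] that by (simp add: act_def algebra_simps)
  show thesis
  proof
    show "f \<in> additive_characters" using f(1) add by (auto simp: additive_characters_def X_def prime_funs_def)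
    show "f \<noteq> 0" by (fact f(2))
    show "f h = 0" if "h \<in> Q" for h
    proof -
      have "f (h \<otimes> \<one>) = f \<one>" "f \<one> = 0" using f(1) that by (simp_all add: X_def)
      then show ?thesis using that Q_sub by (simp add: subsetD)
    qed
  qed
qed

text \<open>One more function costs at most one more point. If some \<open>u\<close> in the larger
  span vanishes on \<open>S\<close> but not at \<open>g\<close>, every other function vanishing on
  \<open>S\<close> is on P a multiple of \<open>u\<close>, so adding \<open>g\<close> to
  \<open>S\<close> suffices.\<close>

lemma finite_set_separating_span:
  fixes F :: "('g \<Rightarrow> 'k) set"
  assumes "finite F"
  shows "\<exists>S\<subseteq>carrier P. finite S \<and> card S \<le> card F \<and>
    (\<forall>f\<in>V.span F. (\<forall>s\<in>S. f s = 0) \<longrightarrow> (\<forall>g\<in>carrier P. f g = 0))"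
  using assms
proof (induction F rule: finite_induct)
  case empty
  then show ?case by (intro exI[of _ "{}"]) (simp add: zero_fun_apply)
next
  case (insert f F)
  then obtain S where S: "S \<subseteq> carrier P" "finite S" "card S \<le> card F"
    "\<And>f g. f \<in> V.span F \<Longrightarrow> \<forall>s\<in>S. f s = 0 \<Longrightarrow> g \<in> carrier P \<Longrightarrow> f g = 0" by blast
  show ?case
  proof (cases "\<forall>u\<in>V.span (insert f F). (\<forall>s\<in>S. u s = 0) \<longrightarrow> (\<forall>g\<in>carrier P. u g = 0)")
    case True
    then show ?thesis using S insert.hyps by (intro exI[of _ S]) auto
  next
    case False
    then obtain u g where u: "u \<in> V.span (insert f F)" "\<forall>s\<in>S. u s = 0" "g \<in> carrier P" "u g \<noteq> 0" by blast
    obtain a where a: "u - a *\<^sub>F f \<in> V.span F" using u(1) unfolding V.span_insert by blast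
    have "a \<noteq> 0"
    proof
      assume "a = 0"
      then have "u \<in> V.span F" using a by simp
      then show False using S(4) u by blast
    qed
    have sep: "v x = 0" if v: "v \<in> V.span (insert f F)" "\<forall>s\<in>insert g S. v s = 0" and x: "x \<in> carrier P" for v x
    proof -
      obtain b where b: "v - b *\<^sub>F f \<in> V.span F" using v(1) unfolding V.span_insert by blast
      \<comment> \<open>The coefficient is chosen to cancel the contributions of \<open>f\<close>:
        \<open>w\<close> lies in the span of \<open>F\<close> and vanishes on \<open>S\<close>,
        hence on P. Evaluation at \<open>g\<close> then shows that \<open>b / a = 0\<close>.\<close>
      define w where "w = v - (b / a) *\<^sub>F u"
      have "w = (v - b *\<^sub>F f) - (b / a) *\<^sub>F (u - a *\<^sub>F f)"
        using \<open>a \<noteq> 0\<close> by (simp add: w_def V.scale_right_diff_distrib)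
      then have "w \<in> V.span F" using a b by (simp only: V.span_diff V.span_scale)
      moreover have "\<forall>s\<in>S. w s = 0" using v(2) u(2) by (simp add: w_def minus_apply fun_scale_apply)
      ultimately have w0: "w y = 0" if "y \<in> carrier P" for y using S(4) that by blast
      have "v g = 0" using v(2) by simp
      then have "b / a * u g = 0" using w0[OF u(3)] by (simp add: w_def minus_apply fun_scale_apply)
      then have "b / a = 0" using u(4) by simp
      then show "v x = 0" using w0[OF x] by (simp only: w_def minus_apply fun_scale_apply) simp
    qed
    show ?thesis
    proof (intro exI[of _ "insert g S"] conjI ballI impI)
      show "insert g S \<subseteq> carrier P" "finite (insert g S)" using S(1,2) u(3) by simp_all
      show "card (insert g S) \<le> card (insert f F)"
        using S(2,3) insert.hyps by (simp add: card_insert_if)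
    qed (rule sep)
  qed
qed

text \<open>Points separating the characters generate P: otherwise a nonzero character would vanish
  on the proper subgroup they generate, hence at all of them.\<close>

lemma generators_from_spanning_characters:
  assumes "finite F" "additive_characters \<subseteq> V.span F"
  obtains S where "S \<subseteq> carrier P" "finite S" "card S \<le> card F" "generate P S = carrier P"
proof -
  obtain S where S: "S \<subseteq> carrier P" "finite S" "card S \<le> card F"
    "\<forall>f\<in>V.span F. (\<forall>s\<in>S. f s = 0) \<longrightarrow> (\<forall>g\<in>carrier P. f g = 0)"
    using finite_set_separating_span[OF assms(1)] by blast
  have "generate P S = carrier P"
  proof (rule ccontr)
    assume "generate P S \<noteq> carrier P"
    from additive_character_vanishing_on[OF generate_is_subgroup[OF S(1)] this]
    obtain f where f: "f \<in> additive_characters" "f \<noteq> 0" "\<And>h. h \<in> generate P S \<Longrightarrow> f h = 0"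
      by blast
    have "f \<in> V.span F" using f(1) assms(2) by blast
    moreover have "\<forall>s\<in>S. f s = 0" by (simp add: f(3) generate.incl)
    ultimately have "\<forall>g\<in>carrier P. f g = 0" using S(4) by simp
    then show False using f(1,2) by (auto simp: additive_characters_def fun_eq_iff zero_fun_apply)
  qed
  then show thesis using that S by blast
qed

section \<open>The derivations attached to additive characters\<close>

definition mult_by :: "('g \<Rightarrow> 'k) \<Rightarrow> ('g \<Rightarrow> 'k) \<Rightarrow> 'g \<Rightarrow> 'k" where
  "mult_by f x = (\<lambda>g. f g * x g)"

lemma mult_by_TD:
  assumes f: "f \<in> additive_characters"
  shows "mult_by f \<in> TD"
proof -
  have f_add: "f (g \<otimes> h) = f g + f h" if "g \<in> carrier P" "h \<in> carrier P" for g h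
    using f that by (simp add: additive_characters_def)
  have f0: "f g = 0" if "g \<notin> carrier P" for g using f that by (simp add: additive_characters_def)
  have "mult_by f (x \<star> y) g = (mult_by f x \<star> y + x \<star> mult_by f y) g" for x y g
  proof (cases "g \<in> carrier P")
    case g: True
    have "f g = f u + f (inv u \<otimes> g)" if "u \<in> carrier P" for u
      using f_add[of u "inv u \<otimes> g"] that g by (simp add: inv_cancel)
    then have "(\<Sum>u\<in>carrier P. f g * (x u * y (inv u \<otimes> g)))
        = (\<Sum>u\<in>carrier P. f u * x u * y (inv u \<otimes> g) + x u * (f (inv u \<otimes> g) * y (inv u \<otimes> g)))"
      by (intro sum.cong) (auto simp: algebra_simps)
    then show ?thesis
      using g by (simp add: mult_by_def star_apply plus_fun_apply sum_distrib_left sum.distrib)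
  qed (simp add: mult_by_def star_apply plus_fun_apply)
  then have "mult_by f (x \<star> y) = mult_by f x \<star> y + x \<star> mult_by f y" for x y by blast
  moreover have "V.endo (mult_by f)"
    by (auto simp: V.endo_iff mult_by_def fun_eq_iff plus_fun_apply fun_scale_apply algebra_simps)
  ultimately show ?thesis
    by (auto simp: TD_def mult_by_def res_def carrier_A f0 fun_eq_iff)
qed

text \<open>The coefficient of g in ag - ga is a(1) - a(1) = 0, so an inner derivation cannot change
  the eigenvalue at a group element. Passing to HH^1 therefore loses no dimension.\<close>

lemma cls_mult_by_inject:
  assumes f: "f \<in> additive_characters" and h: "h \<in> additive_characters"
    and eq: "cls (mult_by f) = cls (mult_by h)"
  shows "f = h"
proof
  fix g
  show "f g = h g"
  proof (cases "g \<in> carrier P")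
    case g: True
    obtain a where a: "\<And>x. mult_by f x = mult_by h x + ad a x"
      using cls_eqD[OF mult_by_TD[OF f] mult_by_TD[OF h] eq] by blast
    have "ad a (delta g) g = 0"
      using g by (simp add: ad_def minus_apply star_delta delta_star)
    then show ?thesis
      using fun_cong[OF a[of "delta g"], of g] by (simp add: mult_by_def plus_fun_apply delta_def)
  qed (use f h in \<open>simp add: additive_characters_def\<close>)
qed

text \<open>Since F = h(F) with \<open>h\<close> free of a linear term, the class of
  \<open>F\<close> is a combination of its iterated \<open>p\<close>-powers, all of which lie in
  every restricted subalgebra containing the first.\<close>

lemma diag_semisimple:
  assumes F: "F \<in> TD" and "diag F"
  shows "semisimple_elem H (cls F)"
proof -
  obtain h where h: "h \<in> p_polys p 1" "V.act F h = F"
    using diag_eq_act[OF F \<open>diag F\<close>] by blast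
  have "cls F \<in> R" if R: "restricted_subalgebra H R" and mem: "p_power H (cls F) \<in> R" for R
  proof -
    have pow: "cls (F ^^ (p ^ Suc i)) \<in> R" for i
    proof (induction i)
      case 0
      then show ?case using mem p_power_H[OF F] by simp
    next
      case (Suc i)
      have "p_power H (cls (F ^^ (p ^ Suc i))) \<in> R"
        using R Suc.IH unfolding restricted_subalgebra_def by blast
      moreover have "p_power H (cls (F ^^ (p ^ Suc i))) = cls ((F ^^ (p ^ Suc i)) ^^ p)"
        by (rule p_power_H[OF TD_power_p_power[OF F]])
      moreover have "(F ^^ (p ^ Suc i)) ^^ p = F ^^ (p ^ Suc (Suc i))"
        unfolding funpow_mult by (simp add: mult_ac)
      ultimately show ?case by simp
    qed
    have "cls (V.act F h) \<in> R"
      using h(1)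
    proof (induction rule: p_polys.induct)
      case zero
      have "V.act F 0 = (\<lambda>x. 0)" by (rule ext) simp
      then show ?case
        using R unfolding restricted_subalgebra_def zero_H by metis
    next
      case (step h i c)
      obtain j where j: "i = Suc j" using step.hyps by (cases i) auto
      have "c \<odot>\<^bsub>H\<^esub> cls (F ^^ (p ^ i)) \<in> R"
        using R pow[of j] unfolding restricted_subalgebra_def j by blast
      then have "cls (V.act F h) \<oplus>\<^bsub>H\<^esub> c \<odot>\<^bsub>H\<^esub> cls (F ^^ (p ^ i)) \<in> R"
        using R step.IH unfolding restricted_subalgebra_def by blast
      also have "cls (V.act F h) \<oplus>\<^bsub>H\<^esub> c \<odot>\<^bsub>H\<^esub> cls (F ^^ (p ^ i))
          = cls (\<lambda>x. V.act F h x + c *\<^sub>F (F ^^ (p ^ i)) x)"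
        unfolding smult_H[OF TD_power_p_power[OF F]]
        by (rule add_H[OF act_TD[OF F step.hyps(1)] TD_scale[OF TD_power_p_power[OF F]]])
      also have "(\<lambda>x. V.act F h x + c *\<^sub>F (F ^^ (p ^ i)) x) = V.act F (h + monom c (p ^ i))"
        by (rule ext) (simp only: V.act_add V.act_monom)
      finally show ?case .
    qed
    then show ?thesis using h(2) by simp
  qed
  then show ?thesis
    unfolding semisimple_elem_def restricted_subalgebra_generated_def by blast
qed

lemma diag_mult_by:
  assumes f: "f \<in> additive_characters"
  shows "diag (mult_by f)"
proof (rule diagI)
  show "V.endo (mult_by f)" by (rule TD_endo[OF mult_by_TD[OF f]])
  have "mult_by f (delta g) = f g *\<^sub>F delta g" for g
    by (auto simp: mult_by_def delta_def fun_scale_apply fun_eq_iff)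
  then have "delta ` carrier P \<subseteq> {u \<in> carrier A. \<exists>m. mult_by f u = m *\<^sub>F u}"
    using delta_in_A by blast
  then show "carrier A \<subseteq> V.span {u \<in> carrier A. \<exists>m. mult_by f u = m *\<^sub>F u}"
    using V.span_mono A_subset_span_delta by blast
qed

definition character_torus :: "(('g \<Rightarrow> 'k) \<Rightarrow> 'g \<Rightarrow> 'k) set set" where
  "character_torus = (\<lambda>f. cls (mult_by f)) ` additive_characters"

lemma subspace_additive_characters: "V.subspace additive_characters"
  by (auto simp: V.subspace_def additive_characters_def zero_fun_apply plus_fun_apply fun_scale_apply
      algebra_simps)

lemma torus_character_torus: "torus H character_torus"
proof -
  have mult: "cls (mult_by f) \<otimes>\<^bsub>H\<^esub> cls (mult_by h) = \<zero>\<^bsub>H\<^esub>"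
    if "f \<in> additive_characters" "h \<in> additive_characters" for f h
  proof -
    have "commutator (mult_by f) (mult_by h) = (\<lambda>x. 0)"
      by (auto simp: commutator_def mult_by_def fun_eq_iff minus_apply zero_fun_apply)
    then show ?thesis using that mult_by_TD by (simp only: mult_H zero_H)
  qed
  have zero: "\<zero>\<^bsub>H\<^esub> \<in> character_torus"
  proof -
    have "mult_by 0 = (\<lambda>x. 0)" by (auto simp: mult_by_def fun_eq_iff zero_fun_apply)
    then show ?thesis
      unfolding character_torus_def zero_H
      using V.subspace_0[OF subspace_additive_characters] by (metis imageI)
  qed
  have "restricted_subalgebra H character_torus"
    unfolding restricted_subalgebra_def
  proof (intro conjI ballI allI zero)
    show "character_torus \<subseteq> carrier H"
      using mult_by_TD by (auto simp: character_torus_def carrier_H)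
    fix x assume "x \<in> character_torus"
    then obtain f where f: "f \<in> additive_characters" "x = cls (mult_by f)"
      by (auto simp: character_torus_def)
    show "x \<oplus>\<^bsub>H\<^esub> y \<in> character_torus" if "y \<in> character_torus" for y
    proof -
      obtain h where h: "h \<in> additive_characters" "y = cls (mult_by h)"
        using \<open>y \<in> character_torus\<close> by (auto simp: character_torus_def)
      have "mult_by (f + h) = (\<lambda>x. mult_by f x + mult_by h x)"
        by (auto simp: mult_by_def plus_fun_apply fun_eq_iff distrib_right)
      then have "x \<oplus>\<^bsub>H\<^esub> y = cls (mult_by (f + h))"
        using f h mult_by_TD by (simp only: add_H)
      then show ?thesis
        using V.subspace_add[OF subspace_additive_characters f(1) h(1)] by (auto simp: character_torus_def)
    qed
    show "x \<otimes>\<^bsub>H\<^esub> y \<in> character_torus" if "y \<in> character_torus" for y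
    proof -
      obtain h where h: "h \<in> additive_characters" "y = cls (mult_by h)"
        using \<open>y \<in> character_torus\<close> by (auto simp: character_torus_def)
      show ?thesis using mult[OF f(1) h(1)] f(2) h(2) zero by simp
    qed
    show "c \<odot>\<^bsub>H\<^esub> x \<in> character_torus" for c
    proof -
      have "mult_by (c *\<^sub>F f) = (\<lambda>x. c *\<^sub>F mult_by f x)"
        by (auto simp: mult_by_def fun_scale_apply fun_eq_iff)
      then have "c \<odot>\<^bsub>H\<^esub> x = cls (mult_by (c *\<^sub>F f))"
        using f mult_by_TD by (simp only: smult_H)
      then show ?thesis
        using V.subspace_scale[OF subspace_additive_characters f(1)] by (auto simp: character_torus_def)
    qed
    show "p_power H x \<in> character_torus"
    proof -
      have "(mult_by f ^^ m) x = (\<lambda>g. f g ^ m * x g)" for m x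
        by (induction m) (simp_all add: mult_by_def mult.assoc)
      then have "mult_by f ^^ p = mult_by (\<lambda>g. f g ^ p)" by (auto simp: mult_by_def)
      then have "p_power H x = cls (mult_by (\<lambda>g. f g ^ p))"
        using f mult_by_TD p_power_H by simp
      \<comment> \<open>Frobenius makes the pointwise \<open>p\<close>-th power of a character a
        character again, and it is the \<open>p\<close>-power of the attached derivation.\<close>
      moreover have "(a + b) ^ p = a ^ p + b ^ p" for a b :: 'k
        by (rule freshmans_dream) (use prime_p char_p in auto)
      then have "(\<lambda>g. f g ^ p) \<in> additive_characters"
        using f(1) p_pos by (auto simp: additive_characters_def)
      ultimately show ?thesis by (auto simp: character_torus_def)
    qed
  qed
  then show ?thesis
    unfolding torus_def using mult diag_semisimple mult_by_TD diag_mult_by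
    by (auto simp: character_torus_def)
qed

section \<open>Bases of tori and the rank\<close>

lemma lin_comb_in_subalgebra:
  assumes R: "restricted_subalgebra H R" and "finite B" "B \<subseteq> R"
  shows "lin_comb H c B \<in> R"
proof -
  interpret abelian_monoid H by (rule abelian_monoid_H)
  have R_H: "R \<subseteq> carrier H" and smult: "\<And>x. x \<in> R \<Longrightarrow> c x \<odot>\<^bsub>H\<^esub> x \<in> R"
    and add: "\<And>x y. x \<in> R \<Longrightarrow> y \<in> R \<Longrightarrow> x \<oplus>\<^bsub>H\<^esub> y \<in> R" and zero: "\<zero>\<^bsub>H\<^esub> \<in> R" for c
    using R unfolding restricted_subalgebra_def by blast+
  show ?thesis
    unfolding lin_comb_def using assms(2,3)
  proof (induction B rule: finite_induct)
    case (insert x B)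
    have "(\<Oplus>\<^bsub>H\<^esub>x\<in>insert x B. c x \<odot>\<^bsub>H\<^esub> x) = c x \<odot>\<^bsub>H\<^esub> x \<oplus>\<^bsub>H\<^esub> (\<Oplus>\<^bsub>H\<^esub>x\<in>B. c x \<odot>\<^bsub>H\<^esub> x)"
      using insert.hyps insert.prems R_H smult by (intro finsum_insert) (auto simp: subset_iff)
    then show ?case using insert smult add by simp
  qed (simp add: zero)
qed

lemma lin_independent_subset: "lin_independent V B \<Longrightarrow> C \<subseteq> B \<Longrightarrow> lin_independent V C"
  unfolding lin_independent_def by blast

definition lift :: "(('g \<Rightarrow> 'k) \<Rightarrow> 'g \<Rightarrow> 'k) set \<Rightarrow> ('g \<Rightarrow> 'k) \<Rightarrow> 'g \<Rightarrow> 'k" where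
  "lift x = (SOME F. F \<in> TD \<and> cls F = x)"

lemma lift: "x \<in> carrier H \<Longrightarrow> lift x \<in> TD" "x \<in> carrier H \<Longrightarrow> cls (lift x) = x"
  unfolding carrier_H lift_def using someI_ex[of "\<lambda>F. F \<in> TD \<and> cls F = x"] by blast+

text \<open>A nontrivial relation must involve \<open>x\<close> and can be solved for it. The
  computation takes place on lifts, where the relation holds up to \<open>ad a\<close>, and this
  term disappears on returning to classes.\<close>

lemma lin_span_if_maximal:
  assumes B: "finite B" "B \<subseteq> carrier H" "lin_independent H B"
    and x: "x \<in> carrier H" "x \<notin> B" "\<not> lin_independent H (insert x B)"
  shows "x \<in> lin_span H B"
proof -
  obtain E c where E: "finite E" "E \<subseteq> insert x B" "lin_comb H c E = \<zero>\<^bsub>H\<^esub>" "\<exists>y\<in>E. c y \<noteq> 0"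
    using x(3) unfolding lin_independent_def by blast
  have EH: "E \<subseteq> carrier H" using E B x by blast
  have lin_comb: "lin_comb H c C = cls (\<lambda>z. \<Sum>s\<in>C. c s *\<^sub>F lift s z)" if "C \<subseteq> E" for C c
    by (rule lin_comb_H) (use that E(1) EH lift finite_subset in blast)+
  have TD: "(\<lambda>z. \<Sum>s\<in>C. c s *\<^sub>F lift s z) \<in> TD" if "C \<subseteq> E" for C c
    using that E(1) EH lift(1) finite_subset by (intro TD_sum TD_scale) blast+
  have "x \<in> E" "c x \<noteq> 0"
  proof -
    show "x \<in> E"
    proof (rule ccontr)
      assume "x \<notin> E"
      then have "E \<subseteq> B" using E by blast
      then show False using B(3) E unfolding lin_independent_def by blast
    qed
    show "c x \<noteq> 0"
    proof
      assume cx: "c x = 0"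
      have "(\<Sum>s\<in>E. c s *\<^sub>F lift s z) = (\<Sum>s\<in>E - {x}. c s *\<^sub>F lift s z)" for z
        using E(1) \<open>x \<in> E\<close> cx by (simp add: sum.remove)
      then have "lin_comb H c (E - {x}) = \<zero>\<^bsub>H\<^esub>"
        using lin_comb[of E] lin_comb[of "E - {x}"] E(3) by simp
      moreover have "E - {x} \<subseteq> B" "finite (E - {x})" using E by auto
      ultimately have "\<forall>y\<in>E - {x}. c y = 0" using B(3) unfolding lin_independent_def by blast
      then show False using E(4) cx by blast
    qed
  qed
  obtain a where a: "\<And>z. (\<Sum>s\<in>E. c s *\<^sub>F lift s z) = 0 + ad a z"
    using cls_eqD[OF TD[of E c] TD_zero] lin_comb[of E c] E(3) zero_H by auto
  have "lin_comb H (\<lambda>s. - c s / c x) (E - {x}) = x"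
  proof -
    have "(\<Sum>s\<in>E - {x}. (- c s / c x) *\<^sub>F lift s z) = lift x z + ad ((- 1 / c x) *\<^sub>F a) z" for z
    proof -
      have "c x *\<^sub>F lift x z + (\<Sum>s\<in>E - {x}. c s *\<^sub>F lift s z) = ad a z"
        using a[of z] E(1) \<open>x \<in> E\<close> by (simp add: sum.remove)
      then have "(\<Sum>s\<in>E - {x}. c s *\<^sub>F lift s z) = ad a z - c x *\<^sub>F lift x z"
        by (simp add: algebra_simps)
      then have "(- 1 / c x) *\<^sub>F (\<Sum>s\<in>E - {x}. c s *\<^sub>F lift s z)
          = (- 1 / c x) *\<^sub>F ad a z + lift x z"
        using \<open>c x \<noteq> 0\<close> by (simp add: V.scale_right_diff_distrib)
      then show ?thesis
        by (simp add: V.scale_sum_right ad_scale add.commute)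
    qed
    then have "cls (\<lambda>z. \<Sum>s\<in>E - {x}. (- c s / c x) *\<^sub>F lift s z) = cls (lift x)"
      by (rule cls_cong)
    then show ?thesis
      using lin_comb[of "E - {x}"] lift(2)[OF x(1)] by simp
  qed
  moreover have "finite (E - {x})" "E - {x} \<subseteq> B" using E by auto
  ultimately show ?thesis unfolding lin_span_def by blast
qed

lemma mem_lin_span: "x \<in> B \<Longrightarrow> B \<subseteq> carrier H \<Longrightarrow> x \<in> lin_span H B"
proof -
  assume x: "x \<in> B" "B \<subseteq> carrier H"
  have "lin_comb H (\<lambda>_. 1) {x} = x"
    using lin_comb_H[of "{x}" lift "\<lambda>_. 1"] lift x by (auto simp: subset_iff)
  then show ?thesis unfolding lin_span_def using x by blast
qed

text \<open>\<open>subspace_dim\<close> chooses a basis with \<open>SOME\<close>, so existence has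
  to be secured first. Independent subsets of a torus are bounded in size by taking all of P as
  generating set, and one of greatest size spans.\<close>

lemma torus_has_basis:
  assumes T: "torus H T"
  obtains B where "is_basis H T B"
proof -
  have sub: "restricted_subalgebra H T" using T by (simp add: torus_def)
  then have T_H: "T \<subseteq> carrier H" by (simp add: restricted_subalgebra_def)
  define Q where "Q B \<longleftrightarrow> finite B \<and> B \<subseteq> T \<and> lin_independent H B" for B
  have gen: "generate P (carrier P) = carrier P"
    using generate_incl[of "carrier P"] generate.incl[of _ "carrier P" P] by blast
  have bound: "card B < Suc (card (carrier P))" if "Q B" for B
    using torus_independent_card_le[OF T subset_refl finite_P gen, of B] that by (simp add: Q_def)
  have "Q {}" by (simp add: Q_def lin_independent_def)
  then obtain B where B: "Q B" "\<And>C. Q C \<Longrightarrow> card C \<le> card B"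
    using ex_has_greatest_nat[of Q "{}" card "Suc (card (carrier P))"] bound by blast
  have "lin_span H B = T"
  proof
    show "lin_span H B \<subseteq> T"
      using lin_comb_in_subalgebra[OF sub] B(1) unfolding lin_span_def Q_def by blast
    show "T \<subseteq> lin_span H B"
    proof
      fix x assume x: "x \<in> T"
      show "x \<in> lin_span H B"
      proof (cases "x \<in> B")
        case True
        then show ?thesis using mem_lin_span B(1) T_H by (auto simp: Q_def)
      next
        case False
        then have "\<not> Q (insert x B)" using B by (metis Q_def card_insert_disjoint not_less_eq_eq order_refl)
        then have "\<not> lin_independent H (insert x B)" using B(1) x by (simp add: Q_def)
        then show ?thesis
          using lin_span_if_maximal[of B x] B(1) x T_H False by (auto simp: Q_def)
      qed
    qed
  qed
  then show thesis using that B(1) T_H by (auto simp: is_basis_def Q_def)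
qed

text \<open>\<open>is_basis\<close> admits infinite sets, whose cardinality would be 0, so
  finiteness is derived by applying the bound to the finite subsets of \<open>B\<close>.\<close>

lemma torus_basis_card_le:
  assumes T: "torus H T" and B: "is_basis H T B"
    and S: "S \<subseteq> carrier P" "finite S" "generate P S = carrier P"
  shows "finite B" "card B \<le> card S"
proof -
  have "B \<subseteq> T" "lin_independent H B"
    using B mem_lin_span unfolding is_basis_def by blast+
  then have le: "card C \<le> card S" if "finite C" "C \<subseteq> B" for C
    using torus_independent_card_le[OF T S, of C] that lin_independent_subset by blast
  show "finite B"
  proof (rule ccontr)
    assume "infinite B"
    then obtain C where "finite C" "card C = Suc (card S)" "C \<subseteq> B"
      using infinite_arbitrarily_large by blast
    then show False using le[of C] by simp
  qed
  then show "card B \<le> card S" using le by blast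
qed

text \<open>By \<open>cls_mult_by_inject\<close> a linear relation between classes is one between
  the characters themselves, so a basis of the torus gives spanning characters and thereby
  generators.\<close>

lemma character_torus_basis_generators:
  assumes B: "is_basis H character_torus B" "finite B"
  obtains S where "S \<subseteq> carrier P" "finite S" "card S \<le> card B" "generate P S = carrier P"
proof -
  have "B \<subseteq> character_torus" using B(1) mem_lin_span unfolding is_basis_def by blast
  then have "\<forall>x\<in>B. \<exists>f\<in>additive_characters. cls (mult_by f) = x" by (auto simp: character_torus_def)
  then obtain \<chi> where \<chi>: "\<forall>x\<in>B. \<chi> x \<in> additive_characters \<and> cls (mult_by (\<chi> x)) = x"
    by (auto simp: Bex_def dest!: bchoice)
  have "additive_characters \<subseteq> V.span (\<chi> ` B)"
  proof
    fix f assume f: "f \<in> additive_characters"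
    then have "cls (mult_by f) \<in> lin_span H B"
      using B(1) by (auto simp: is_basis_def character_torus_def)
    then obtain c C where C: "finite C" "C \<subseteq> B" "cls (mult_by f) = lin_comb H c C"
      unfolding lin_span_def by blast
    define h where "h = (\<Sum>x\<in>C. c x *\<^sub>F \<chi> x)"
    have h: "h \<in> additive_characters"
      unfolding h_def using \<chi> C(2)
      by (intro V.subspace_sum V.subspace_scale subspace_additive_characters) auto
    have "lin_comb H c C = cls (\<lambda>z. \<Sum>x\<in>C. c x *\<^sub>F mult_by (\<chi> x) z)"
      using C \<chi> mult_by_TD by (intro lin_comb_H) auto
    also have "(\<lambda>z. \<Sum>x\<in>C. c x *\<^sub>F mult_by (\<chi> x) z) = mult_by h"
      by (auto simp: mult_by_def h_def fun_eq_iff sum_fun_apply fun_scale_apply sum_distrib_right mult.assoc)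
    finally have "f = h" using cls_mult_by_inject[OF f h] C(3) by simp
    also have "h \<in> V.span (\<chi> ` B)"
      unfolding h_def using C(2) by (intro V.span_sum V.span_scale V.span_base) auto
    finally show "f \<in> V.span (\<chi> ` B)" .
  qed
  then obtain S where S: "S \<subseteq> carrier P" "finite S" "card S \<le> card (\<chi> ` B)" "generate P S = carrier P"
    using generators_from_spanning_characters[of "\<chi> ` B"] B(2) by blast
  then show thesis using that card_image_le[OF B(2), of \<chi>] by (meson order_trans)
qed

lemma mt_rank_H: "mt_rank H = min_num_generators P"
proof -
  define d where "d = min_num_generators P"
  let ?gen = "\<lambda>n. \<exists>S. S \<subseteq> carrier P \<and> finite S \<and> card S = n \<and> generate P S = carrier P"
  have "generate P (carrier P) = carrier P"
    using generate_incl[of "carrier P"] generate.incl[of _ "carrier P" P] by blast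
  then have "?gen (card (carrier P))" using finite_P by blast
  then have "?gen d" unfolding d_def min_num_generators_def by (rule LeastI)
  then obtain S where S: "S \<subseteq> carrier P" "finite S" "card S = d" "generate P S = carrier P" by blast
  have d_le: "d \<le> card S'" if "S' \<subseteq> carrier P" "finite S'" "generate P S' = carrier P" for S'
    unfolding d_def min_num_generators_def using that by (intro Least_le) blast
  have basis: "is_basis H T (SOME B. is_basis H T B)" if "torus H T" for T
    using torus_has_basis[OF that] by (metis someI)
  have le: "subspace_dim H T \<le> d" if "torus H T" for T
    using torus_basis_card_le(2)[OF that basis[OF that] S(1,2,4)] S(3) by (simp add: subspace_dim_def)
  let ?B = "SOME B. is_basis H character_torus B"
  note T = torus_character_torus
  obtain S' where S': "S' \<subseteq> carrier P" "finite S'" "card S' \<le> card ?B" "generate P S' = carrier P"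
    using character_torus_basis_generators[OF basis[OF T] torus_basis_card_le(1)[OF T basis[OF T] S(1,2,4)]]
    by blast
  have "d \<le> card ?B" using d_le[OF S'(1,2,4)] S'(3) by simp
  then have "subspace_dim H character_torus = d"
    using le[OF T] by (simp add: subspace_dim_def)
  \<comment> \<open>\<open>Max\<close> is determined by its elements only on a finite set; the upper
    bound provides this.\<close>
  moreover have "finite {subspace_dim H T | T. torus H T}"
    by (rule finite_subset[of _ "{..d}"]) (use le in auto)
  ultimately show ?thesis
    unfolding mt_rank_def d_def[symmetric] using le T by (intro Max_eqI) auto
qed

end

theorem proposition5p12:
  fixes p :: nat and P :: "('g, 'b) monoid_scheme"
  assumes "prime p"
    and "group P" and "finite (carrier P)" and "\<exists>n. Coset.order P = p ^ n"
    and "CHAR('k::alg_closed_field) = p"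
  shows "mt_rank (HH1 (group_algebra P :: ('k, 'g \<Rightarrow> 'k) module)) = min_num_generators P"
proof -
  obtain n where "Coset.order P = p ^ n" using assms(4) by blast
  then interpret p_group_algebra P "group_algebra P :: ('k, 'g \<Rightarrow> 'k) module" p n
    using assms by (simp add: p_group_algebra_def p_group_algebra_axioms_def)
  show ?thesis by (rule mt_rank_H)
qed

end
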